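(* Let $\Gamma$ be a finitely generated virtually abelian group and let $S\subseteq\Gamma$ be a finite symmetric set of generators with $e\notin S$. Then there exists a constant $C$, depending only on $\Gamma$ and $S$, such that $$|\kappa_n(e,g)|\le \frac{C}{d(e,g)}\qquad\text{for every } g\in\Gamma\setminus\{e\}\text{ and every } n\in\mathbb{N}.$$
   Context: A group is virtually abelian if it has a normal abelian subgroup of finite index. A subset $S$ is symmetric if $S=S^{-1}$. $d$ is the shortest-path distance of the Cayley graph of $\Gamma$ with respect to $S$ (vertices $\Gamma$; $g\sim h$ iff $g^{-1}h\in S$), i.e. the word distance. Let $\mu$ be the probability measure on $\Gamma$ with $\mu(e)=\tfrac12$, $\mu(s)=\tfrac1{2|S|}$ for $s\in S$, and $0$ otherwise. Let $\mu^{\ast n}$ be its $n$-fold convolution, where $(\alpha\ast\beta)(g)=\sum_h\alpha(h)\beta(h^{-1}g)$, and let $\mu^{\ast n}_g(h)=\mu^{\ast n}(g^{-1}h)$ (the law of the $n$-step $1/2$-lazy symmetric random walk from $g$). $W_1$ is the $1$-Wasserstein distance with respect to $d$: $W_1(\alpha,\beta)=\inf_\pi\sum_{g,h}d(g,h)\pi(g,h)$ over couplings $\pi$ of $\alpha,\beta$. The Ollivier--Ricci curvature at large scales is $\kappa_n(g,h)=1-\frac{W_1(\mu^{\ast n}_g,\mu^{\ast n}_h)}{d(g,h)}$ for $g\ne h$ and $n\in\mathbb{N}$. *)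

theory Defs
  imports "HOL-Algebra.Algebra" "HOL-Analysis.Analysis"
begin

definition virtually_abelian :: "('a, 'b) monoid_scheme \<Rightarrow> bool" where
  "virtually_abelian G \<longleftrightarrow>
     (\<exists>H. H \<lhd> G \<and> comm_group (G\<lparr>carrier := H\<rparr>) \<and> finite (rcosets\<^bsub>G\<^esub> H))"

definition cayley_edges :: "('a, 'b) monoid_scheme \<Rightarrow> 'a set \<Rightarrow> ('a \<times> 'a) set" where
  "cayley_edges G S =
     {(g, h). g \<in> carrier G \<and> h \<in> carrier G \<and> inv\<^bsub>G\<^esub> g \<otimes>\<^bsub>G\<^esub> h \<in> S}"

text \<open>
  The shortest-path distance. It is meaningful only if the Cayley graph is connected,
  that is, if \<open>S\<close> is a symmetric generating set.
\<close>

definition cayley_dist :: "('a, 'b) monoid_scheme \<Rightarrow> 'a set \<Rightarrow> 'a \<Rightarrow> 'a \<Rightarrow> nat" where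
  "cayley_dist G S g h = (LEAST n. (g, h) \<in> cayley_edges G S ^^ n)"

text \<open>
  Measures on the (discrete, countable) group are represented by their mass functions;
  values outside the carrier are irrelevant.
\<close>

definition lazy_step :: "('a, 'b) monoid_scheme \<Rightarrow> 'a set \<Rightarrow> 'a \<Rightarrow> real" where
  "lazy_step G S g =
     (if g = \<one>\<^bsub>G\<^esub> then 1 / 2 else if g \<in> S then 1 / (2 * real (card S)) else 0)"

definition convolution ::
    "('a, 'b) monoid_scheme \<Rightarrow> ('a \<Rightarrow> real) \<Rightarrow> ('a \<Rightarrow> real) \<Rightarrow> 'a \<Rightarrow> real" where
  "convolution G \<alpha> \<beta> g = (\<Sum>\<^sub>\<infinity>h\<in>carrier G. \<alpha> h * \<beta> (inv\<^bsub>G\<^esub> h \<otimes>\<^bsub>G\<^esub> g))"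

text \<open>The empty convolution power is the point mass at the identity.\<close>

primrec convolution_power ::
    "('a, 'b) monoid_scheme \<Rightarrow> ('a \<Rightarrow> real) \<Rightarrow> nat \<Rightarrow> 'a \<Rightarrow> real" where
  "convolution_power G \<alpha> 0 = (\<lambda>g. if g = \<one>\<^bsub>G\<^esub> then 1 else 0)"
| "convolution_power G \<alpha> (Suc n) = convolution G (convolution_power G \<alpha> n) \<alpha>"

definition lazy_walk :: "('a, 'b) monoid_scheme \<Rightarrow> 'a set \<Rightarrow> nat \<Rightarrow> 'a \<Rightarrow> 'a \<Rightarrow> real" where
  "lazy_walk G S n g h = convolution_power G (lazy_step G S) n (inv\<^bsub>G\<^esub> g \<otimes>\<^bsub>G\<^esub> h)"

definition couplings ::
    "'a set \<Rightarrow> ('a \<Rightarrow> real) \<Rightarrow> ('a \<Rightarrow> real) \<Rightarrow> ('a \<times> 'a \<Rightarrow> real) set" where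
  "couplings V \<alpha> \<beta> =
     {\<pi>. (\<forall>g\<in>V. \<forall>h\<in>V. 0 \<le> \<pi> (g, h)) \<and>
         (\<forall>g\<in>V. ((\<lambda>h. \<pi> (g, h)) has_sum \<alpha> g) V) \<and>
         (\<forall>h\<in>V. ((\<lambda>g. \<pi> (g, h)) has_sum \<beta> h) V)}"

text \<open>
  Couplings of infinite cost do not contribute to the infimum, since \<open>has_sum\<close> requires
  a finite value. For finitely supported probability measures, such as the laws of the
  walk, every coupling has finite cost and the set below is nonempty.
\<close>

definition wasserstein1 ::
    "'a set \<Rightarrow> ('a \<Rightarrow> 'a \<Rightarrow> real) \<Rightarrow> ('a \<Rightarrow> real) \<Rightarrow> ('a \<Rightarrow> real) \<Rightarrow> real" where
  "wasserstein1 V d \<alpha> \<beta> =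
     Inf {c. \<exists>\<pi>\<in>couplings V \<alpha> \<beta>. ((\<lambda>(g, h). d g h * \<pi> (g, h)) has_sum c) (V \<times> V)}"

definition ollivier_ricci ::
    "('a, 'b) monoid_scheme \<Rightarrow> 'a set \<Rightarrow> nat \<Rightarrow> 'a \<Rightarrow> 'a \<Rightarrow> real" where
  "ollivier_ricci G S n g h =
     1 - wasserstein1 (carrier G) (\<lambda>x y. real (cayley_dist G S x y))
           (lazy_walk G S n g) (lazy_walk G S n h)
         / real (cayley_dist G S g h)"

end

theory Submission
  imports Defs "HOL-Probability.Probability_Mass_Function"
begin

text \<open>
  Write \<open>|g|\<close> for the word length and \<open>X\<close> for the walk started at the identity, so that the
  walk from \<open>g\<close> is \<open>g X\<close>. The bound on the curvature says that \<open>W\<^sub>1\<close> of the laws of \<open>X\<close> and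
  \<open>g X\<close> differs from \<open>|g|\<close> by at most a constant. Let \<open>H\<close> be a normal abelian subgroup of
  finite index. Everything rests on one observation: an element of \<open>H\<close> has only finitely
  many conjugates, and they are obtained by conjugating with coset representatives of
  bounded length, so conjugation changes the length of an element of \<open>H\<close> by at most a
  constant, \<open>len_conj_le\<close>.

  Upper bound. If \<open>g\<close> and \<open>h\<close> lie in the same coset of \<open>H\<close>, let both walks use the same
  increments. Their distance after \<open>n\<close> steps is the length of a conjugate of \<open>g\<inverse>h \<in> H\<close>,
  hence at most \<open>d(g, h)\<close> plus a constant. For arbitrary \<open>g\<close> and \<open>h\<close>, let the walks move
  independently until they occupy the same coset and then let them use the same increments.
  Because of the laziness, the waiting time has a tail that decays exponentially at a rate
  that does not depend on \<open>g\<close>, \<open>h\<close> and \<open>n\<close>, and each step of waiting costs at most 2. This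
  is \<open>walk_coupling_exists\<close>.

  Lower bound. For \<open>a \<in> H\<close>, take minus the average of the distances to a high power
  \<open>a\<^sup>K\<close> along the orbit of \<open>a\<close>. This 1-Lipschitz function grows by nearly \<open>|a\<^sup>K| / K\<close> when its argument is
  multiplied by \<open>a\<close>, \<open>orbit_height_translate\<close>; so \<open>W\<^sub>1\<close> is at least about \<open>|a\<^sup>K| / K\<close>. It
  remains to see that \<open>|a\<^sup>K| / K \<ge> |a| - C\<close>, and for powers of two it is enough that
  \<open>2|a| \<le> |a\<^sup>2| + C\<close>, \<open>len_square_ge\<close>. A geodesic from the identity to \<open>a\<^sup>2\<close> projects to a
  closed path in the finite quotient and decomposes into short loops. Up to conjugation,
  they represent only finitely many elements of \<open>H\<close>. Since \<open>H\<close> is abelian, the loops can be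
  rearranged and halved: this gives an element \<open>b\<close> of length at most \<open>|a\<^sup>2|/2 + C\<close> such that
  \<open>(a b\<inverse>)\<^sup>2\<close> ranges over a finite set. A finitely generated abelian group has only finitely
  many elements of order two, so \<open>a b\<inverse>\<close> ranges over a finite set as well. An arbitrary \<open>g\<close>
  is at bounded distance from some \<open>a \<in> H\<close>, and the upper bound allows passing from one to
  the other.
\<close>

section \<open>The word metric\<close>

locale cayley_graph = group G for G :: "('a, 'b) monoid_scheme" (structure) +
  fixes S :: "'a set"
  assumes finite_S: "finite S"
    and S_subset: "S \<subseteq> carrier G"
    and generate_S: "generate G S = carrier G"
    and S_symmetric: "set_inv S = S"
    and one_notin_S: "\<one> \<notin> S"
begin

abbreviation "E \<equiv> cayley_edges G S"
abbreviation "d \<equiv> cayley_dist G S"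

definition len :: "'a \<Rightarrow> nat" where "len g = d \<one> g"

lemma inv_in_S: "s \<in> S \<Longrightarrow> inv s \<in> S"
  using S_symmetric by (auto simp: SET_INV_def)

lemma S_carrier: "s \<in> S \<Longrightarrow> s \<in> carrier G"
  using S_subset by auto

lemma inv_cancel_left: "x \<in> carrier G \<Longrightarrow> y \<in> carrier G \<Longrightarrow> inv x \<otimes> (x \<otimes> y) = y"
  and inv_cancel_left': "x \<in> carrier G \<Longrightarrow> y \<in> carrier G \<Longrightarrow> x \<otimes> (inv x \<otimes> y) = y"
  by (simp_all flip: m_assoc)

lemma edge_path_closed: "(g, h) \<in> E ^^ n \<Longrightarrow> g \<in> carrier G \<Longrightarrow> h \<in> carrier G"
proof (induction n arbitrary: h)
  case (Suc n)
  then obtain k where "(k, h) \<in> E" by (meson relpow_Suc_E)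
  then show ?case unfolding cayley_edges_def by blast
qed simp

lemma edge_translate:
  assumes "x \<in> carrier G" "(g, h) \<in> E" shows "(x \<otimes> g, x \<otimes> h) \<in> E"
  using assms by (auto simp: cayley_edges_def inv_mult_group m_assoc inv_cancel_left)

lemma path_translate:
  "x \<in> carrier G \<Longrightarrow> (g, h) \<in> E ^^ n \<Longrightarrow> (x \<otimes> g, x \<otimes> h) \<in> E ^^ n"
proof (induction n arbitrary: h)
  case (Suc n)
  then obtain k where "(g, k) \<in> E ^^ n" "(k, h) \<in> E" by (meson relpow_Suc_E)
  then show ?case using Suc edge_translate relpow_Suc_I by metis
qed simp

lemma path_translate_iff:
  assumes "x \<in> carrier G" "g \<in> carrier G" "h \<in> carrier G"
  shows "(x \<otimes> g, x \<otimes> h) \<in> E ^^ n \<longleftrightarrow> (g, h) \<in> E ^^ n"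
  using path_translate[OF assms(1), of g h n]
    path_translate[OF inv_closed[OF assms(1)], of "x \<otimes> g" "x \<otimes> h" n] assms
  by (auto simp: inv_cancel_left)

lemma dist_translate:
  "x \<in> carrier G \<Longrightarrow> g \<in> carrier G \<Longrightarrow> h \<in> carrier G \<Longrightarrow> d (x \<otimes> g) (x \<otimes> h) = d g h"
  by (simp add: cayley_dist_def path_translate_iff)

lemma dist_eq_len:
  assumes "g \<in> carrier G" "h \<in> carrier G" shows "d g h = len (inv g \<otimes> h)"
  using dist_translate[of "inv g" g h] assms by (simp add: len_def)

lemma path_mult:
  assumes "(\<one>, g) \<in> E ^^ n" "(\<one>, h) \<in> E ^^ m"
  shows "(\<one>, g \<otimes> h) \<in> E ^^ (n + m)"
proof -
  have g: "g \<in> carrier G" using assms(1) edge_path_closed by blast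
  have "(g, g \<otimes> h) \<in> E ^^ m" using path_translate[OF g assms(2)] g by simp
  with assms(1) show ?thesis by (auto simp: relpow_add)
qed

lemma path_generator: "s \<in> S \<Longrightarrow> (\<one>, s) \<in> E ^^ 1"
  using S_carrier by (simp add: cayley_edges_def)

lemma path_exists: "g \<in> carrier G \<Longrightarrow> \<exists>n. (\<one>, g) \<in> E ^^ n"
proof -
  assume "g \<in> carrier G"
  then have "g \<in> generate G S" by (simp add: generate_S)
  then show ?thesis
  proof induction
    case one then show ?case by (intro exI[of _ 0]) simp
  next
    case (incl h) then show ?case using path_generator by blast
  next
    case (inv h) then show ?case using path_generator inv_in_S by blast
  next
    case (eng h1 h2) then show ?case using path_mult by blast
  qed
qed

lemma path_len: "g \<in> carrier G \<Longrightarrow> (\<one>, g) \<in> E ^^ len g"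
  unfolding len_def cayley_dist_def using path_exists by (rule LeastI_ex)

lemma len_le: "(\<one>, g) \<in> E ^^ n \<Longrightarrow> len g \<le> n"
  unfolding len_def cayley_dist_def by (rule Least_le)

lemma len_one [simp]: "len \<one> = 0"
  using len_le[of \<one> 0] by simp

lemma len_generator: "s \<in> insert \<one> S \<Longrightarrow> len s \<le> 1"
  using len_le[OF path_generator] by fastforce

lemma len_mult: "g \<in> carrier G \<Longrightarrow> h \<in> carrier G \<Longrightarrow> len (g \<otimes> h) \<le> len g + len h"
  by (intro len_le path_mult path_len)

lemma len_pos: "g \<in> carrier G \<Longrightarrow> g \<noteq> \<one> \<Longrightarrow> 0 < len g"
  using path_len[of g] by (cases "len g") auto

lemma edge_sym: "(g, h) \<in> E \<Longrightarrow> (h, g) \<in> E"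
  using inv_in_S by (fastforce simp: cayley_edges_def inv_mult_group)

lemma path_sym: "(g, h) \<in> E ^^ n \<Longrightarrow> (h, g) \<in> E ^^ n"
proof (induction n arbitrary: h)
  case (Suc n)
  then obtain k where "(g, k) \<in> E ^^ n" "(k, h) \<in> E" by (meson relpow_Suc_E)
  then show ?case using Suc.IH edge_sym by (meson relpow_Suc_I2)
qed simp

lemma dist_sym: "d g h = d h g"
  unfolding cayley_dist_def using path_sym by metis

lemma len_inv: assumes "g \<in> carrier G" shows "len (inv g) = len g"
  using dist_sym[of g \<one>] assms dist_eq_len[of g \<one>] by (simp add: len_def)

lemma dist_triangle:
  assumes "x \<in> carrier G" "y \<in> carrier G" "z \<in> carrier G"
  shows "d x z \<le> d x y + d y z"
proof -
  have "inv x \<otimes> z = (inv x \<otimes> y) \<otimes> (inv y \<otimes> z)"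
    using assms by (simp add: m_assoc inv_cancel_left')
  then show ?thesis using len_mult[of "inv x \<otimes> y" "inv y \<otimes> z"] assms by (simp add: dist_eq_len)
qed

lemma len_pow: "g \<in> carrier G \<Longrightarrow> len (g [^] (n::nat)) \<le> n * len g"
proof (induction n)
  case (Suc n)
  then show ?case using len_mult[of "g [^] n" g] by simp
qed simp

lemma geodesic:
  assumes "g \<in> carrier G"
  obtains p where "p 0 = \<one>" "p (len g) = g" "\<And>i. i \<le> len g \<Longrightarrow> p i \<in> carrier G"
    "\<And>i j. i \<le> j \<Longrightarrow> j \<le> len g \<Longrightarrow> len (inv (p i) \<otimes> p j) \<le> j - i"
proof -
  from path_len[OF assms] obtain p where p: "p 0 = \<one>" "p (len g) = g"
    and e: "\<And>i. i < len g \<Longrightarrow> (p i, p (Suc i)) \<in> E"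
    unfolding relpow_fun_conv by blast
  have c: "p i \<in> carrier G" if "i \<le> len g" for i
  proof (cases "i = len g")
    case False
    with that have "i < len g" by simp
    from e[OF this] show ?thesis by (auto simp: cayley_edges_def)
  qed (use p assms in auto)
  have "len (inv (p i) \<otimes> p j) \<le> j - i" if "i \<le> j" "j \<le> len g" for i j
    using that
  proof (induction j rule: dec_induct)
    case base then show ?case using c[of i] by simp
  next
    case (step j)
    have "len (inv (p j) \<otimes> p (Suc j)) \<le> 1"
      using e[of j] step by (intro len_generator) (auto simp: cayley_edges_def)
    moreover have "d (p i) (p (Suc j)) \<le> d (p i) (p j) + d (p j) (p (Suc j))"
      using step c by (intro dist_triangle) auto
    ultimately show ?case using step c[of i] c[of j] c[of "Suc j"] by (simp add: dist_eq_len)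
  qed
  with p c that show ?thesis by blast
qed

lemma finite_ball: "finite {g \<in> carrier G. len g \<le> n}"
proof (induction n)
  case 0
  have "{g \<in> carrier G. len g \<le> 0} \<subseteq> {\<one>}" using len_pos by fastforce
  then show ?case using finite_subset by blast
next
  case (Suc n)
  let ?B = "{g \<in> carrier G. len g \<le> n}"
  have "g \<in> ?B \<union> (\<lambda>(x, s). x \<otimes> s) ` (?B \<times> S)" if g: "g \<in> carrier G" "len g \<le> Suc n" for g
  proof (cases "len g \<le> n")
    case False
    with g have l: "len g = Suc n" by simp
    from path_len[OF g(1)] obtain x where x: "(\<one>, x) \<in> E ^^ n" "(x, g) \<in> E"
      unfolding l by (meson relpow_Suc_E)
    then have "x \<in> ?B" "inv x \<otimes> g \<in> S" "x \<in> carrier G"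
      using len_le by (auto simp: cayley_edges_def)
    moreover have "g = x \<otimes> (inv x \<otimes> g)" using g calculation by (simp add: inv_cancel_left')
    ultimately show ?thesis by (auto intro!: image_eqI[of _ _ "(x, inv x \<otimes> g)"])
  qed (use g in auto)
  then have "{g \<in> carrier G. len g \<le> Suc n} \<subseteq> ?B \<union> (\<lambda>(x, s). x \<otimes> s) ` (?B \<times> S)" by auto
  then show ?case using Suc finite_S by (meson finite_SigmaI finite_UnI finite_imageI finite_subset)
qed

end

section \<open>Conjugation in a virtually abelian group\<close>

locale virtually_abelian_cayley_graph = cayley_graph +
  fixes H :: "'a set"
  assumes normal_H: "H \<lhd> G"
    and comm_group_H: "comm_group (G\<lparr>carrier := H\<rparr>)"
    and finite_rcosets_H: "finite (rcosets H)"
    and S_nonempty: "S \<noteq> {}"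
begin

sublocale normal H G by (fact normal_H)

lemma H_carrier: "a \<in> H \<Longrightarrow> a \<in> carrier G"
  using subset by auto

lemma H_comm: "a \<in> H \<Longrightarrow> b \<in> H \<Longrightarrow> a \<otimes> b = b \<otimes> a"
  using comm_monoid.m_comm[OF comm_group.axioms(1)[OF comm_group_H]] by simp

text \<open>
  Finitely many cosets have finitely many representatives, whose lengths are therefore bounded.
\<close>
lemma ex_transversal_bound:
  "\<exists>D. \<forall>x\<in>carrier G. \<exists>t\<in>carrier G. len t \<le> D \<and> x \<otimes> inv t \<in> H"
proof -
  define t where "t c = (SOME t. t \<in> c)" for c :: "'a set"
  have t: "t (H #> x) \<in> carrier G \<and> x \<otimes> inv (t (H #> x)) \<in> H" if x: "x \<in> carrier G" for x
  proof -
    have "t (H #> x) \<in> H #> x"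
      unfolding t_def using rcos_self[OF x subgroup_axioms] by (rule someI)
    then obtain h where h: "h \<in> H" "t (H #> x) = h \<otimes> x" by (auto simp: r_coset_def)
    then have "x \<otimes> inv (t (H #> x)) = inv h"
      using x by (simp add: inv_mult_group inv_cancel_left' H_carrier)
    with h x show ?thesis by (auto simp: H_carrier)
  qed
  have "len (t (H #> x)) \<le> Max ((\<lambda>c. len (t c)) ` (rcosets H))" if "x \<in> carrier G" for x
    using that finite_rcosets_H by (intro Max_ge) (auto simp: RCOSETS_def)
  with t show ?thesis by blast
qed

definition transversal_bound :: nat where
  "transversal_bound = (SOME D. \<forall>x\<in>carrier G. \<exists>t\<in>carrier G. len t \<le> D \<and> x \<otimes> inv t \<in> H)"

abbreviation "D \<equiv> transversal_bound"

lemma transversal: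
  assumes "x \<in> carrier G"
  obtains b t where "b \<in> H" "t \<in> carrier G" "len t \<le> D" "x = b \<otimes> t"
proof -
  have "\<forall>x\<in>carrier G. \<exists>t\<in>carrier G. len t \<le> D \<and> x \<otimes> inv t \<in> H"
    unfolding transversal_bound_def by (rule someI_ex[OF ex_transversal_bound])
  with assms obtain t where t: "t \<in> carrier G" "len t \<le> D" "x \<otimes> inv t \<in> H" by blast
  have "x = (x \<otimes> inv t) \<otimes> t" using t assms by (simp add: m_assoc)
  with t that show ?thesis by blast
qed

lemma transversal_left:
  assumes "x \<in> carrier G"
  obtains t a where "t \<in> carrier G" "len t \<le> D" "a \<in> H" "x = t \<otimes> a"
proof -
  obtain b t where bt: "b \<in> H" "t \<in> carrier G" "len t \<le> D" "x = b \<otimes> t"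
    using transversal[OF assms] by blast
  have "x = t \<otimes> (inv t \<otimes> b \<otimes> t)"
    using bt by (simp add: m_assoc inv_cancel_left' H_carrier)
  with that inv_op_closed1 bt show ?thesis by blast
qed

text \<open>
  As \<open>H\<close> is abelian, a conjugate of an element of \<open>H\<close> depends only on the coset of the conjugating
  element.
\<close>
lemma conj_transversal:
  assumes "a \<in> H" "b \<in> H" "t \<in> carrier G"
  shows "inv (b \<otimes> t) \<otimes> a \<otimes> (b \<otimes> t) = inv t \<otimes> a \<otimes> t"
proof -
  have "inv (b \<otimes> t) \<otimes> a \<otimes> (b \<otimes> t) = inv t \<otimes> (inv b \<otimes> (a \<otimes> b)) \<otimes> t"
    using assms by (simp add: inv_mult_group m_assoc H_carrier)
  also have "inv b \<otimes> (a \<otimes> b) = a"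
    using H_comm[OF assms(1,2)] assms by (simp add: inv_cancel_left H_carrier)
  finally show ?thesis .
qed

text \<open>
  Both halves of the proof rest on this estimate. The conjugating element may be replaced by a coset
  representative of length at most \<open>D\<close>.
\<close>
lemma len_conj_le:
  assumes "a \<in> H" "x \<in> carrier G" shows "len (inv x \<otimes> a \<otimes> x) \<le> len a + 2 * D"
proof -
  obtain b t where bt: "b \<in> H" "t \<in> carrier G" "len t \<le> D" "x = b \<otimes> t"
    using transversal[OF assms(2)] by blast
  then have "inv x \<otimes> a \<otimes> x = inv t \<otimes> a \<otimes> t" using conj_transversal assms by simp
  moreover have "len (inv t \<otimes> a \<otimes> t) \<le> len (inv t) + len a + len t"
    using bt assms len_mult[of "inv t \<otimes> a" t] len_mult[of "inv t" a] by (simp add: H_carrier)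
  ultimately show ?thesis using bt len_inv[of t] by simp
qed

section \<open>Coupling two walks up to a bounded error\<close>

definition step_pmf :: "'a pmf" where
  "step_pmf = bind_pmf (bernoulli_pmf (1/2)) (\<lambda>b. if b then return_pmf \<one> else pmf_of_set S)"

primrec walk_pmf :: "nat \<Rightarrow> 'a pmf" where
  "walk_pmf 0 = return_pmf \<one>"
| "walk_pmf (Suc n) = bind_pmf step_pmf (\<lambda>s. map_pmf ((\<otimes>) s) (walk_pmf n))"

lemma pmf_step_pmf: "pmf step_pmf x = lazy_step G S x"
  using one_notin_S S_nonempty finite_S
  by (auto simp: step_pmf_def pmf_bind lazy_step_def pmf_return indicator_def)

lemma set_step_pmf: "set_pmf step_pmf = insert \<one> S"
  using S_nonempty finite_S by (auto simp: step_pmf_def set_pmf_bernoulli UNIV_bool)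

lemma step_carrier: "s \<in> set_pmf step_pmf \<Longrightarrow> s \<in> carrier G"
  using set_step_pmf S_carrier by auto

lemma finite_set_walk [simp]: "finite (set_pmf (walk_pmf n))"
  by (induction n) (use finite_S in \<open>auto simp: set_step_pmf\<close>)

lemma walk_len: "x \<in> set_pmf (walk_pmf n) \<Longrightarrow> x \<in> carrier G \<and> len x \<le> n"
proof (induction n arbitrary: x)
  case (Suc n)
  then obtain s y where "s \<in> insert \<one> S" "y \<in> set_pmf (walk_pmf n)" "x = s \<otimes> y"
    unfolding walk_pmf.simps set_bind_pmf set_map_pmf set_step_pmf by blast
  then show ?case
    using Suc.IH[of y] len_mult[of s y] len_generator[of s] S_carrier by fastforce
qed auto

lemma walk_carrier: "x \<in> set_pmf (walk_pmf n) \<Longrightarrow> x \<in> carrier G"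
  using walk_len by blast

definition walk_from :: "nat \<Rightarrow> 'a \<Rightarrow> 'a pmf" where
  "walk_from n g = map_pmf ((\<otimes>) g) (walk_pmf n)"

lemma walk_from_Suc:
  assumes "g \<in> carrier G"
  shows "walk_from (Suc n) g = bind_pmf step_pmf (\<lambda>s. walk_from n (g \<otimes> s))"
  unfolding walk_from_def walk_pmf.simps map_bind_pmf pmf.map_comp
  by (intro bind_pmf_cong map_pmf_cong refl)
     (use assms in \<open>auto simp: m_assoc step_carrier walk_carrier\<close>)

text \<open>
  The walk adds a new increment on the left in \<open>walk_pmf\<close>, which suits arguments that condition on the first
  step; convolution powers add it on the right.
\<close>
lemma walk_pmf_Suc_right:
  "walk_pmf (Suc n) = bind_pmf (walk_pmf n) (\<lambda>x. map_pmf ((\<otimes>) x) step_pmf)"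
proof (induction n)
  case 0
  have "map_pmf ((\<otimes>) \<one>) step_pmf = map_pmf (\<lambda>s. s \<otimes> \<one>) step_pmf"
    by (intro map_pmf_cong refl) (simp add: step_carrier)
  then show ?case by (simp add: bind_return_pmf map_pmf_def)
next
  case (Suc n)
  have "walk_pmf (Suc (Suc n)) =
      bind_pmf step_pmf (\<lambda>s. bind_pmf (walk_pmf n) (\<lambda>x. map_pmf (\<lambda>t. s \<otimes> (x \<otimes> t)) step_pmf))"
    by (subst walk_pmf.simps, subst Suc) (simp add: map_bind_pmf pmf.map_comp o_def)
  also have "\<dots> =
      bind_pmf step_pmf (\<lambda>s. bind_pmf (walk_pmf n) (\<lambda>x. map_pmf (\<lambda>t. (s \<otimes> x) \<otimes> t) step_pmf))"
    by (intro bind_pmf_cong map_pmf_cong refl) (simp add: m_assoc step_carrier walk_carrier)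
  also have "\<dots> = bind_pmf (walk_pmf (Suc n)) (\<lambda>x. map_pmf ((\<otimes>) x) step_pmf)"
    by (simp add: bind_assoc_pmf bind_map_pmf)
  finally show ?case .
qed

definition walk_coupling :: "nat \<Rightarrow> 'a \<Rightarrow> 'a \<Rightarrow> real \<Rightarrow> bool" where
  "walk_coupling n g h c \<longleftrightarrow> (\<exists>\<pi>. map_pmf fst \<pi> = walk_from n g \<and> map_pmf snd \<pi> = walk_from n h \<and>
     measure_pmf.expectation \<pi> (\<lambda>(x, y). real (d x y)) \<le> c)"

lemma finite_set_walk_from [simp]: "finite (set_pmf (walk_from n g))"
  by (simp add: walk_from_def)

lemma set_coupling_subset:
  "map_pmf fst \<pi> = p \<Longrightarrow> map_pmf snd \<pi> = q \<Longrightarrow> set_pmf \<pi> \<subseteq> set_pmf p \<times> set_pmf q"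
  by force

lemma finite_set_coupling:
  "map_pmf fst \<pi> = walk_from n g \<Longrightarrow> map_pmf snd \<pi> = walk_from m h \<Longrightarrow> finite (set_pmf \<pi>)"
  by (rule finite_subset[OF set_coupling_subset]) auto

lemma walk_coupling_mono: "walk_coupling n g h c \<Longrightarrow> c \<le> c' \<Longrightarrow> walk_coupling n g h c'"
  unfolding walk_coupling_def by fastforce

lemma expectation_mono_finite:
  assumes "finite (set_pmf p)" "\<And>x. x \<in> set_pmf p \<Longrightarrow> f x \<le> g x"
  shows "measure_pmf.expectation p f \<le> measure_pmf.expectation p (g :: _ \<Rightarrow> real)"
  using assms by (intro integral_mono_AE integrable_measure_pmf_finite) (auto simp: AE_measure_pmf_iff)

text \<open>
  Equal increments keep the walks at a distance that is the length of a conjugate of \<open>inv g \<otimes> h\<close>.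
\<close>
lemma walk_coupling_same_coset:
  assumes g: "g \<in> carrier G" and h: "h \<in> carrier G" and H: "inv g \<otimes> h \<in> H"
  shows "walk_coupling n g h (d g h + 2 * D)"
proof -
  let ?\<pi> = "map_pmf (\<lambda>x. (g \<otimes> x, h \<otimes> x)) (walk_pmf n)"
  have "real (d (g \<otimes> x) (h \<otimes> x)) \<le> d g h + 2 * D" if "x \<in> set_pmf (walk_pmf n)" for x
  proof -
    have x: "x \<in> carrier G" using that walk_carrier by blast
    then have "d (g \<otimes> x) (h \<otimes> x) = len (inv x \<otimes> (inv g \<otimes> h) \<otimes> x)"
      using g h by (simp add: dist_eq_len inv_mult_group m_assoc)
    also have "\<dots> \<le> len (inv g \<otimes> h) + 2 * D" using H x by (rule len_conj_le)
    finally show ?thesis using g h by (simp add: dist_eq_len)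
  qed
  then have "measure_pmf.expectation (walk_pmf n) (\<lambda>x. real (d (g \<otimes> x) (h \<otimes> x)))
      \<le> measure_pmf.expectation (walk_pmf n) (\<lambda>x. d g h + 2 * D)"
    by (intro expectation_mono_finite) auto
  then show ?thesis
    unfolding walk_coupling_def walk_from_def
    by (intro exI[of _ ?\<pi>]) (simp add: pmf.map_comp o_def)
qed

text \<open>
  The first steps of the two walks are taken independently; the couplings that are used afterwards may
  depend on them.
\<close>
lemma walk_coupling_Suc:
  assumes g: "g \<in> carrier G" and h: "h \<in> carrier G"
    and IH: "\<And>s t. s \<in> insert \<one> S \<Longrightarrow> t \<in> insert \<one> S \<Longrightarrow> walk_coupling n (g \<otimes> s) (h \<otimes> t) (c (s, t))"
  shows "walk_coupling (Suc n) g h (measure_pmf.expectation (pair_pmf step_pmf step_pmf) c)"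
proof -
  let ?P = "pair_pmf step_pmf step_pmf"
  have "\<forall>z\<in>set_pmf ?P. \<exists>\<pi>. map_pmf fst \<pi> = walk_from n (g \<otimes> fst z) \<and>
      map_pmf snd \<pi> = walk_from n (h \<otimes> snd z) \<and>
      measure_pmf.expectation \<pi> (\<lambda>(x, y). real (d x y)) \<le> c z"
    using IH by (auto simp: walk_coupling_def set_step_pmf)
  then obtain \<pi> where \<pi>: "\<And>z. z \<in> set_pmf ?P \<Longrightarrow> map_pmf fst (\<pi> z) = walk_from n (g \<otimes> fst z)"
    "\<And>z. z \<in> set_pmf ?P \<Longrightarrow> map_pmf snd (\<pi> z) = walk_from n (h \<otimes> snd z)"
    "\<And>z. z \<in> set_pmf ?P \<Longrightarrow> measure_pmf.expectation (\<pi> z) (\<lambda>(x, y). real (d x y)) \<le> c z"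
    unfolding bchoice_iff by blast
  have fP: "finite (set_pmf ?P)" using finite_S by (simp add: set_step_pmf)
  have "map_pmf fst (bind_pmf ?P \<pi>) = bind_pmf ?P (\<lambda>z. walk_from n (g \<otimes> fst z))"
    unfolding map_bind_pmf by (intro bind_pmf_cong refl \<pi>)
  also have "\<dots> = bind_pmf (map_pmf fst ?P) (\<lambda>s. walk_from n (g \<otimes> s))"
    by (simp add: bind_map_pmf)
  finally have 1: "map_pmf fst (bind_pmf ?P \<pi>) = walk_from (Suc n) g"
    using g by (simp add: walk_from_Suc map_fst_pair_pmf)
  have "map_pmf snd (bind_pmf ?P \<pi>) = bind_pmf ?P (\<lambda>z. walk_from n (h \<otimes> snd z))"
    unfolding map_bind_pmf by (intro bind_pmf_cong refl \<pi>)
  also have "\<dots> = bind_pmf (map_pmf snd ?P) (\<lambda>s. walk_from n (h \<otimes> s))"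
    by (simp add: bind_map_pmf)
  finally have 2: "map_pmf snd (bind_pmf ?P \<pi>) = walk_from (Suc n) h"
    using h by (simp add: walk_from_Suc map_snd_pair_pmf)
  have "measure_pmf.expectation (bind_pmf ?P \<pi>) (\<lambda>(x, y). real (d x y)) =
      (\<Sum>z\<in>set_pmf ?P. pmf ?P z *\<^sub>R measure_pmf.expectation (\<pi> z) (\<lambda>(x, y). real (d x y)))"
    by (rule pmf_expectation_bind[OF fP]) (use \<pi> finite_set_coupling in blast)+
  also have "\<dots> \<le> (\<Sum>z\<in>set_pmf ?P. c z * pmf ?P z)"
    by (intro sum_mono) (simp only: real_scaleR_def mult.commute[of "c _"], intro mult_left_mono \<pi> pmf_nonneg)
  also have "\<dots> = measure_pmf.expectation ?P c"
    by (rule integral_measure_pmf_real[symmetric, OF fP])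
  finally show ?thesis using 1 2 unfolding walk_coupling_def by blast
qed

lemma dist_step_le:
  assumes "g \<in> carrier G" "h \<in> carrier G" "s \<in> insert \<one> S" "t \<in> insert \<one> S"
  shows "d (g \<otimes> s) (h \<otimes> t) \<le> d g h + 2"
proof -
  have st: "s \<in> carrier G" "t \<in> carrier G" using assms S_carrier by auto
  have 1: "d (g \<otimes> s) g \<le> 1" using assms st len_generator[of s] len_inv[of s]
    by (simp add: dist_eq_len inv_mult_group m_assoc)
  have 2: "d h (h \<otimes> t) \<le> 1" using assms st len_generator[of t]
    by (simp add: dist_eq_len inv_cancel_left)
  have "d (g \<otimes> s) (h \<otimes> t) \<le> d (g \<otimes> s) g + d g (h \<otimes> t)"
    "d g (h \<otimes> t) \<le> d g h + d h (h \<otimes> t)"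
    using assms st by (auto intro!: dist_triangle)
  with 1 2 show ?thesis by linarith
qed

text \<open>
  For two walks whose cosets are at distance at most \<open>j\<close> in the quotient graph, the coupling is shown to have cost at most
  their distance plus \<open>M - coset_bonus (D - j)\<close>, where \<open>M\<close> is constant. With probability
  \<open>p = 1 / (4 * card S)\<close> an independent first step reduces this bound by one, and it always adds at most 2 to the
  distance. So the estimate is inherited if \<open>p\<close> times the bonus of \<open>j - 1\<close> is 2 plus the bonus of \<open>j\<close>,
  which is the recursion.
\<close>
primrec coset_bonus :: "nat \<Rightarrow> real" where
  "coset_bonus 0 = 0"
| "coset_bonus (Suc i) = (2 + coset_bonus i) * (4 * card S)"

lemma coset_bonus_mono: "mono coset_bonus"
proof -
  have S: "1 \<le> real (card S)" using S_nonempty finite_S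
    by (metis One_nat_def Suc_leI card_gt_0_iff of_nat_1 of_nat_mono)
  have nonneg: "0 \<le> coset_bonus i" for i
    by (induction i) simp_all
  have "coset_bonus i \<le> coset_bonus (Suc i)" for i
  proof -
    have "(2 + coset_bonus i) * 1 \<le> (2 + coset_bonus i) * (4 * card S)"
      using nonneg[of i] S by (intro mult_left_mono) auto
    then show ?thesis by simp
  qed
  then show ?thesis by (simp add: mono_iff_le_Suc)
qed

definition coupling_cost :: real where
  "coupling_cost = 2 * D + coset_bonus D"

lemma first_generator:
  assumes "w \<in> carrier G" "len w = Suc j"
  obtains s w' where "s \<in> S" "w' \<in> carrier G" "len w' \<le> j" "w = s \<otimes> w'"
proof -
  from path_len[OF assms(1)] obtain s where s: "(\<one>, s) \<in> E" "(s, w) \<in> E ^^ j"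
    unfolding assms(2) by (meson relpow_Suc_E2)
  then have "s \<in> S" "s \<in> carrier G" by (auto simp: cayley_edges_def)
  moreover have "len (inv s \<otimes> w) \<le> j"
    using path_translate[of "inv s", OF _ s(2)] \<open>s \<in> carrier G\<close> by (intro len_le) simp
  ultimately show ?thesis
    using that[of s "inv s \<otimes> w"] assms by (simp add: inv_cancel_left')
qed

text \<open>
  As long as the walks occupy different cosets, the first steps are taken independently. The event
  that gains the bonus is that the walk from \<open>g\<close> uses the first letter of \<open>w\<close> while the walk from
  \<open>h\<close> rests; this is where laziness enters.
\<close>
lemma walk_coupling_potential:
  assumes "g \<in> carrier G" "h \<in> carrier G" "j \<le> D"
    and "w \<in> carrier G" "len w \<le> j" "a \<in> H" "inv g \<otimes> h = w \<otimes> a"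
  shows "walk_coupling n g h (d g h + (coupling_cost - coset_bonus (D - j)))"
  using assms
proof (induction n arbitrary: g h j w a)
  case 0
  have "0 \<le> coupling_cost - coset_bonus (D - j)"
    using monoD[OF coset_bonus_mono, of "D - j" D] by (simp add: coupling_cost_def)
  with 0 show ?case
    unfolding walk_coupling_def
    by (intro exI[of _ "return_pmf (g, h)"]) (simp add: walk_from_def)
next
  case (Suc n)
  note gh = Suc.prems(1,2)
  have general: "walk_coupling n g h (d g h + coupling_cost)"
    if gh: "g \<in> carrier G" "h \<in> carrier G" for g h
  proof -
    obtain t a where ta: "t \<in> carrier G" "len t \<le> D" "a \<in> H" "inv g \<otimes> h = t \<otimes> a"
      using transversal_left[of "inv g \<otimes> h"] gh by auto
    with gh have "walk_coupling n g h (d g h + (coupling_cost - coset_bonus (D - D)))"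
      by (intro Suc.IH[of g h D t a]) auto
    then show ?thesis by simp
  qed
  show ?case
  proof (cases "len w = 0")
    case True
    then have "w = \<one>" using len_pos Suc.prems by fastforce
    then have "inv g \<otimes> h \<in> H" using Suc.prems H_carrier by simp
    from walk_coupling_same_coset[OF gh this, of "Suc n"] show ?thesis
      by (rule walk_coupling_mono)
         (use monoD[OF coset_bonus_mono, of "D - j" D] in \<open>simp add: coupling_cost_def\<close>)
  next
    case False
    then obtain i where i: "len w = Suc i" using not0_implies_Suc by blast
    obtain s0 w' where s0: "s0 \<in> S" "w' \<in> carrier G" "len w' \<le> i" "w = s0 \<otimes> w'"
      using first_generator[OF Suc.prems(4) i] by blast
    obtain k where k: "j = Suc k" using i Suc.prems by (cases j) auto
    have kD: "D - k = Suc (D - j)" using k Suc.prems by simp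
    define c where "c z = d g h + 2 + coupling_cost - coset_bonus (D - k) * indicator {(s0, \<one>)} z"
      for z :: "'a \<times> 'a"
    have "walk_coupling n (g \<otimes> s) (h \<otimes> t) (c (s, t))"
      if st: "s \<in> insert \<one> S" "t \<in> insert \<one> S" for s t
    proof -
      have stc: "s \<in> carrier G" "t \<in> carrier G" using st S_carrier by auto
      have dist: "real (d (g \<otimes> s) (h \<otimes> t)) \<le> d g h + 2"
        using dist_step_le[OF gh st] by linarith
      show ?thesis
      proof (cases "(s, t) = (s0, \<one>)")
        case True
        have "inv (g \<otimes> s0) \<otimes> h = inv s0 \<otimes> (inv g \<otimes> h)"
          using gh True stc by (simp add: inv_mult_group m_assoc)
        also have "\<dots> = w' \<otimes> a"
          using Suc.prems s0 True stc by (simp add: m_assoc H_carrier inv_cancel_left)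
        finally have "walk_coupling n (g \<otimes> s) (h \<otimes> t)
            (d (g \<otimes> s) (h \<otimes> t) + (coupling_cost - coset_bonus (D - k)))"
          using gh True stc Suc.prems s0 i k by (intro Suc.IH[of _ _ k w' a]) auto
        then show ?thesis
          by (rule walk_coupling_mono) (use dist True in \<open>simp add: c_def\<close>)
      next
        case False
        then show ?thesis
          using general[of "g \<otimes> s" "h \<otimes> t"] gh stc dist
          by (auto intro: walk_coupling_mono simp: c_def)
      qed
    qed
    from walk_coupling_Suc[OF gh this]
    have coupling: "walk_coupling (Suc n) g h (measure_pmf.expectation (pair_pmf step_pmf step_pmf) c)" .
    have "integrable (measure_pmf (pair_pmf step_pmf step_pmf)) (indicat_real {(s0, \<one>)})"
      using finite_S by (intro integrable_measure_pmf_finite) (simp add: set_step_pmf)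
    then have "measure_pmf.expectation (pair_pmf step_pmf step_pmf) c
        = d g h + 2 + coupling_cost - coset_bonus (D - k) * pmf (pair_pmf step_pmf step_pmf) (s0, \<one>)"
      unfolding c_def by (subst Bochner_Integration.integral_diff) (auto simp: measure_pmf_single)
    moreover
    have "pmf (pair_pmf step_pmf step_pmf) (s0, \<one>) = 1 / (4 * card S)"
      using s0 one_notin_S by (auto simp: pmf_pair pmf_step_pmf lazy_step_def)
    moreover have "coset_bonus (D - k) * (1 / (4 * card S)) = 2 + coset_bonus (D - j)"
      unfolding kD using S_nonempty finite_S by simp
    ultimately have "measure_pmf.expectation (pair_pmf step_pmf step_pmf) c
        = d g h + (coupling_cost - coset_bonus (D - j))" by simp
    then show ?thesis using coupling by simp
  qed
qed

theorem walk_coupling_exists: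
  assumes "g \<in> carrier G" "h \<in> carrier G"
  shows "walk_coupling n g h (d g h + coupling_cost)"
proof -
  obtain t a where ta: "t \<in> carrier G" "len t \<le> D" "a \<in> H" "inv g \<otimes> h = t \<otimes> a"
    using transversal_left[of "inv g \<otimes> h"] assms by auto
  with assms have "walk_coupling n g h (d g h + (coupling_cost - coset_bonus (D - D)))"
    by (intro walk_coupling_potential[of g h D t a]) auto
  then show ?thesis by simp
qed

end

section \<open>Two-torsion of finitely generated abelian groups\<close>

context comm_group
begin

text \<open>
  The exponents \<open>i\<close> with \<open>c [^] i \<in> K\<close> form a subgroup \<open>I\<close> of the integers. A square root of the
  identity of the form \<open>y \<otimes> c [^] i\<close> satisfies \<open>2 * i \<in> I\<close>, and the integers with this property fall into at most
  two classes modulo \<open>I\<close>. Hence one translate of the two-torsion of \<open>K\<close> at most has to be added.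
\<close>
lemma finite_two_torsion_set_mult_cyclic:
  assumes K: "subgroup K G" and c: "c \<in> carrier G"
    and fin: "finite {x \<in> K. x \<otimes> x = \<one>}"
  shows "finite {x \<in> K <#> generate G {c}. x \<otimes> x = \<one>}"
proof -
  define I where "I = {i::int. c [^] i \<in> K}"
  interpret K: subgroup K G by (rule K)
  have add: "i + j \<in> I" if "i \<in> I" "j \<in> I" for i j
    using K.m_closed[of "c [^] i" "c [^] j"] that c by (simp add: I_def int_pow_mult)
  have pow_K: "x [^] k \<in> K" if "x \<in> K" for x and k :: int
    using that K.subgroup_axioms subgroup_int_pow_closed by blast
  have mult: "i * k \<in> I" if "i \<in> I" for i k
    using that pow_K[of "c [^] i" k] c by (simp add: I_def int_pow_pow)
  have half: "i - j \<in> I" if ij: "2 * i \<in> I" "2 * j \<in> I" "i \<notin> I" "j \<notin> I" for i j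
  proof -
    \<comment> \<open>Bezout puts \<open>2 * ?h\<close> into \<open>I\<close>, so \<open>i\<close> and \<open>j\<close> are both odd multiples of \<open>?h\<close>.\<close>
    let ?h = "gcd i j"
    obtain u v where uv: "i = ?h * u" "j = ?h * v" by (meson dvdE gcd_dvd1 gcd_dvd2)
    obtain r s where "r * (2 * i) + s * (2 * j) = gcd (2 * i) (2 * j)"
      using bezout_int by blast
    moreover have "gcd (2 * i) (2 * j) = 2 * ?h"
      by (simp add: gcd_mult_distrib_int[symmetric])
    moreover have "(2 * i) * r + (2 * j) * s \<in> I" 
      using add[OF mult[OF ij(1), of r] mult[OF ij(2), of s]] .
    ultimately have h: "2 * ?h \<in> I" by (simp add: mult.commute)
    have odd: "odd w" if "k = ?h * w" "k \<notin> I" for k w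
      using mult[OF h] that by (metis evenE mult.assoc mult.commute)
    have "even (u - v)" using odd[OF uv(1) ij(3)] odd[OF uv(2) ij(4)] by simp
    then obtain w where "u - v = 2 * w" by (rule evenE)
    then have "i - j = (2 * ?h) * w" using uv by (metis mult.assoc mult.commute right_diff_distrib)
    then show ?thesis using mult[OF h] by simp
  qed
  let ?T = "{x \<in> K. x \<otimes> x = \<one>}" and ?T' = "{x \<in> K <#> generate G {c}. x \<otimes> x = \<one>}"
  have T'E: "\<exists>y i. y \<in> K \<and> x = y \<otimes> c [^] (i::int) \<and> 2 * i \<in> I" if "x \<in> ?T'" for x
  proof -
    from that obtain y i where yi: "y \<in> K" "x = y \<otimes> c [^] (i::int)" "x \<otimes> x = \<one>"
      using c by (auto simp: set_mult_def generate_pow)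
    have "(y \<otimes> y) \<otimes> (c [^] (2 * i)) = x \<otimes> x"
      using yi c by (simp add: m_ac flip: int_pow_mult mult_2)
    then have "c [^] (2 * i) = inv (y \<otimes> y)"
      using yi c by (metis K.mem_carrier K.m_closed int_pow_closed inv_equality inv_inv m_comm)
    then have "2 * i \<in> I" using yi by (simp add: I_def)
    with yi show ?thesis by blast
  qed
  show ?thesis
  proof (cases "?T' \<subseteq> K")
    case True
    then show ?thesis by (intro finite_subset[OF _ fin]) auto
  next
    case False
    then obtain x0 where x0: "x0 \<in> ?T'" "x0 \<notin> K" by blast
    obtain y0 j where y0: "y0 \<in> K" "x0 = y0 \<otimes> c [^] (j::int)" "2 * j \<in> I"
      using T'E[OF x0(1)] by blast
    have x0c: "x0 \<in> carrier G" using y0 c by simp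
    have "x \<in> ?T \<union> (\<lambda>z. z \<otimes> x0) ` ?T" if x: "x \<in> ?T'" for x
    proof (cases "x \<in> K")
      case False
      obtain y i where y: "y \<in> K" "x = y \<otimes> c [^] (i::int)" "2 * i \<in> I"
        using T'E[OF x] by blast
      have xc: "x \<in> carrier G" using y c by simp
      have "i \<notin> I" "j \<notin> I" using y y0 False x0 by (auto simp: I_def)
      then have ij: "c [^] (i - j) \<in> K" using half y y0 by (simp add: I_def)
      have "x \<otimes> inv x0 = (y \<otimes> inv y0) \<otimes> c [^] (i - j)"
        using y y0 c by (simp add: int_pow_diff inv_mult m_ac)
      then have "x \<otimes> inv x0 \<in> K" using y y0 ij by simp
      moreover have "(x \<otimes> inv x0) \<otimes> (x \<otimes> inv x0) = (x \<otimes> x) \<otimes> inv (x0 \<otimes> x0)"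
        using xc x0c by (simp add: inv_mult m_ac)
      then have "(x \<otimes> inv x0) \<otimes> (x \<otimes> inv x0) = \<one>" using x x0 by simp
      moreover have "x = (x \<otimes> inv x0) \<otimes> x0" using xc x0c by (simp add: m_assoc)
      ultimately show ?thesis by blast
    qed (use x in auto)
    then have "?T' \<subseteq> ?T \<union> (\<lambda>z. z \<otimes> x0) ` ?T" by blast
    then show ?thesis by (rule finite_subset) (use fin in auto)
  qed
qed

lemma finite_two_torsion_generate:
  assumes "finite C" "C \<subseteq> carrier G"
  shows "finite {x \<in> generate G C. x \<otimes> x = \<one>}"
  using assms
proof (induction C)
  case empty
  then show ?case by (simp add: generate_empty)
next
  case (insert c C)
  have sub: "subgroup (generate G C) G" "subgroup (generate G {c}) G"
    using insert by (auto intro: generate_is_subgroup)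
  have "c = \<one> \<otimes> c" "\<one> \<in> generate G C" "c \<in> generate G {c}"
    using insert by (auto intro: generate.intros)
  then have "c \<in> generate G C <#> generate G {c}" unfolding set_mult_def by blast
  moreover have "x \<in> generate G C <#> generate G {c}" if "x \<in> C" for x
  proof -
    have "x = x \<otimes> \<one>" "x \<in> generate G C" "\<one> \<in> generate G {c}"
      using insert that by (auto intro: generate.intros)
    then show ?thesis unfolding set_mult_def by blast
  qed
  ultimately have "generate G (insert c C) \<subseteq> generate G C <#> generate G {c}"
    by (intro generate_subgroup_incl mult_subgroups sub) auto
  moreover have "finite {x \<in> generate G C <#> generate G {c}. x \<otimes> x = \<one>}"
    using insert by (intro finite_two_torsion_set_mult_cyclic sub) auto
  ultimately show ?case by (elim finite_subset[rotated]) auto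
qed

lemma finite_square_roots:
  assumes "finite {x \<in> carrier G. x \<otimes> x = \<one>}"
  shows "finite {x \<in> carrier G. x \<otimes> x = y}"
proof (cases "{x \<in> carrier G. x \<otimes> x = y} = {}")
  case False
  then obtain x0 where x0: "x0 \<in> carrier G" "x0 \<otimes> x0 = y" by blast
  have "x \<in> (\<lambda>z. z \<otimes> x0) ` {x \<in> carrier G. x \<otimes> x = \<one>}" if x: "x \<in> carrier G" "x \<otimes> x = y" for x
  proof -
    have "(x \<otimes> inv x0) \<otimes> (x \<otimes> inv x0) = (x \<otimes> x) \<otimes> inv (x0 \<otimes> x0)"
      using x(1) x0(1) by (simp add: inv_mult m_ac)
    then have "(x \<otimes> inv x0) \<otimes> (x \<otimes> inv x0) = \<one>" using x x0 by auto
    moreover have "x = (x \<otimes> inv x0) \<otimes> x0" using x x0 by (simp add: m_assoc)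
    ultimately show ?thesis using x x0 by (intro image_eqI[of _ _ "x \<otimes> inv x0"]) auto
  qed
  then have "{x \<in> carrier G. x \<otimes> x = y} \<subseteq> (\<lambda>z. z \<otimes> x0) ` {x \<in> carrier G. x \<otimes> x = \<one>}" by blast
  then show ?thesis using assms finite_subset by blast
qed (metis finite.emptyI)

end

section \<open>The word length is almost homogeneous on the abelian subgroup\<close>

context virtually_abelian_cayley_graph
begin

text \<open>
  Loops that are cut out of a geodesic end up conjugated by the path leading to them; the minimal
  length of a conjugate is blind to this, and it differs from the length by a bounded amount on \<open>H\<close>.
\<close>
definition conj_len :: "'a \<Rightarrow> nat" where
  "conj_len a = (LEAST n. \<exists>x\<in>carrier G. n = len (inv x \<otimes> a \<otimes> x))"

lemma conj_len_attained:
  obtains x where "x \<in> carrier G" "len (inv x \<otimes> a \<otimes> x) = conj_len a"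
proof -
  have "\<exists>x\<in>carrier G. conj_len a = len (inv x \<otimes> a \<otimes> x)"
    unfolding conj_len_def by (rule LeastI_ex) blast
  with that show ?thesis by auto
qed

lemma conj_len_le_conj: "x \<in> carrier G \<Longrightarrow> conj_len a \<le> len (inv x \<otimes> a \<otimes> x)"
  unfolding conj_len_def by (rule Least_le) blast

lemma conj_len_le_len: "a \<in> carrier G \<Longrightarrow> conj_len a \<le> len a"
  using conj_len_le_conj[of \<one> a] by simp

lemma conj_len_conj_le:
  assumes "a \<in> carrier G" "x \<in> carrier G" shows "conj_len (x \<otimes> a \<otimes> inv x) \<le> conj_len a"
proof -
  obtain y where y: "y \<in> carrier G" "len (inv y \<otimes> a \<otimes> y) = conj_len a"
    using conj_len_attained by blast
  have "inv (x \<otimes> y) \<otimes> (x \<otimes> a \<otimes> inv x) \<otimes> (x \<otimes> y) = inv y \<otimes> a \<otimes> y"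
    using assms y by (simp add: inv_mult_group m_assoc inv_cancel_left)
  then show ?thesis using conj_len_le_conj[of "x \<otimes> y" "x \<otimes> a \<otimes> inv x"] assms y by simp
qed

lemma len_le_conj_len:
  assumes "a \<in> H" shows "len a \<le> conj_len a + 2 * D"
proof -
  obtain x where x: "x \<in> carrier G" "len (inv x \<otimes> a \<otimes> x) = conj_len a"
    using conj_len_attained by blast
  have "inv (inv x) \<otimes> (inv x \<otimes> a \<otimes> x) \<otimes> inv x = a"
    using assms x by (simp add: H_carrier m_assoc inv_cancel_left')
  then show ?thesis
    using len_conj_le[of "inv x \<otimes> a \<otimes> x" "inv x"] x assms inv_op_closed1 by simp
qed

lemma pow_conj:
  assumes "a \<in> carrier G" "x \<in> carrier G"
  shows "inv x \<otimes> a [^] (n::nat) \<otimes> x = (inv x \<otimes> a \<otimes> x) [^] n"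
proof (induction n)
  case (Suc n)
  have "inv x \<otimes> a [^] Suc n \<otimes> x = (inv x \<otimes> a [^] n \<otimes> x) \<otimes> (inv x \<otimes> a \<otimes> x)"
    using assms by (simp add: m_assoc inv_cancel_left')
  then show ?case using Suc by simp
qed (use assms in simp)

lemma pow_in_H: "a \<in> H \<Longrightarrow> a [^] (n::nat) \<in> H"
  by (induction n) auto

lemma len_pow_le:
  assumes "a \<in> H" shows "len (a [^] (n::nat)) \<le> n * conj_len a + 2 * D"
proof -
  obtain x where x: "x \<in> carrier G" "len (inv x \<otimes> a \<otimes> x) = conj_len a"
    using conj_len_attained by blast
  have "conj_len (a [^] n) \<le> len ((inv x \<otimes> a \<otimes> x) [^] n)"
    using conj_len_le_conj[OF x(1), of "a [^] n"] pow_conj[of a x n] assms x by (simp add: H_carrier)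
  also have "\<dots> \<le> n * conj_len a"
    using len_pow[of "inv x \<otimes> a \<otimes> x" n] x assms by (simp add: H_carrier)
  finally show ?thesis using len_le_conj_len[OF pow_in_H[OF assms, of n]] by simp
qed

text \<open>
  The number of cosets bounds the length of a path in the Cayley graph before its image in the quotient
  closes a loop.
\<close>
definition short_elements :: "'a set" where
  "short_elements = {c \<in> H. conj_len c \<le> card (rcosets H)}"

lemma finite_short_elements: "finite short_elements"
proof (rule finite_subset)
  show "short_elements \<subseteq> {g \<in> carrier G. len g \<le> card (rcosets H) + 2 * D}"
    using len_le_conj_len by (fastforce simp: short_elements_def H_carrier)
qed (rule finite_ball)

text \<open>
  By the pigeonhole principle, two of the first vertices of a geodesic that represents a shortest conjugate
  of \<open>a\<close> lie in the same coset. The segment between them is a loop in the quotient, which can be moved to the front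
  at no expense of minimal conjugate length.
\<close>
lemma split_off_short_loop:
  assumes a: "a \<in> H" and long: "card (rcosets H) < conj_len a"
  obtains c r where "c \<in> short_elements" "r \<in> H" "a = c \<otimes> r"
    "conj_len c + conj_len r \<le> conj_len a" "conj_len r < conj_len a"
proof -
  let ?N = "card (rcosets H)"
  obtain x where x: "x \<in> carrier G" "len (inv x \<otimes> a \<otimes> x) = conj_len a"
    using conj_len_attained by blast
  define a' where "a' = inv x \<otimes> a \<otimes> x"
  have a': "a' \<in> H" "len a' = conj_len a" using a x inv_op_closed1 by (auto simp: a'_def)
  obtain p where p: "p 0 = \<one>" "p (len a') = a'" "\<And>i. i \<le> len a' \<Longrightarrow> p i \<in> carrier G"
    "\<And>i j. i \<le> j \<Longrightarrow> j \<le> len a' \<Longrightarrow> len (inv (p i) \<otimes> p j) \<le> j - i"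
    using geodesic[OF H_carrier[OF a'(1)]] by metis
  have "\<not> inj_on (\<lambda>i. H #> p i) {0..?N}"
  proof (rule pigeonhole)
    have "(\<lambda>i. H #> p i) ` {0..?N} \<subseteq> rcosets H"
      using p(3) long a' subset by (intro image_subsetI rcosetsI) auto
    then have "card ((\<lambda>i. H #> p i) ` {0..?N}) \<le> ?N"
      using finite_rcosets_H by (rule card_mono[rotated])
    then show "card ((\<lambda>i. H #> p i) ` {0..?N}) < card {0..?N}" by simp
  qed
  then obtain i j where ij: "i < j" "j \<le> ?N" "H #> p i = H #> p j"
    unfolding inj_on_def by (metis atLeastAtMost_iff linorder_neqE_nat)
  have pc: "p i \<in> carrier G" "p j \<in> carrier G" using ij long a' by (auto intro!: p(3))
  \<comment> \<open>the loop from \<open>p i\<close> to \<open>p j\<close>, conjugated back to the identity\<close>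
  define c where "c = p j \<otimes> inv (p i)"
  define r where "r = inv c \<otimes> a'"
  have "p j \<in> H #> p i" using rcos_self[OF pc(2) subgroup_axioms] ij by simp
  then obtain h where "h \<in> H" "p j = h \<otimes> p i" by (auto simp: r_coset_def)
  then have c: "c \<in> H" using pc by (simp add: c_def m_assoc H_carrier)
  then have r: "r \<in> H" using a' by (simp add: r_def)
  have "conj_len c \<le> len (inv (p i) \<otimes> c \<otimes> p i)" by (rule conj_len_le_conj[OF pc(1)])
  also have "inv (p i) \<otimes> c \<otimes> p i = inv (p i) \<otimes> p j" using pc by (simp add: c_def m_assoc)
  also have "len \<dots> \<le> j - i" using ij long a' by (intro p(4)) auto
  finally have len_c: "conj_len c \<le> j - i" .
  have "r = p i \<otimes> (inv (p j) \<otimes> a')"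
    using pc a' by (simp add: r_def c_def inv_mult_group m_assoc H_carrier)
  then have "len r \<le> len (p i) + len (inv (p j) \<otimes> a')"
    using len_mult[of "p i" "inv (p j) \<otimes> a'"] pc a' by (simp add: H_carrier)
  moreover have "len (p i) \<le> i" using p(4)[of 0 i] p(1) pc ij long a' by simp
  moreover have "len (inv (p j) \<otimes> a') \<le> len a' - j" using p(4)[of j "len a'"] p(2) ij long a' by simp
  moreover have "conj_len r \<le> len r" using conj_len_le_len r H_carrier by blast
  ultimately have len_r: "conj_len r \<le> i + (conj_len a - j)" using a' by simp
  have "x \<otimes> a' \<otimes> inv x = a"
    using x a by (simp add: a'_def m_assoc H_carrier inv_cancel_left')
  moreover have "a' = c \<otimes> r" using c a' by (simp add: r_def H_carrier inv_cancel_left')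
  ultimately have "a = (x \<otimes> c \<otimes> inv x) \<otimes> (x \<otimes> r \<otimes> inv x)"
    using x c r by (simp add: m_assoc H_carrier inv_cancel_left)
  moreover have "conj_len (x \<otimes> c \<otimes> inv x) \<le> j - i" "conj_len (x \<otimes> r \<otimes> inv x) \<le> i + (conj_len a - j)"
    using conj_len_conj_le[of c x] conj_len_conj_le[of r x] len_c len_r c r x
    by (auto simp: H_carrier intro: order_trans)
  moreover have "x \<otimes> c \<otimes> inv x \<in> H" "x \<otimes> r \<otimes> inv x \<in> H" using inv_op_closed2 x c r by auto
  ultimately show ?thesis
    using that[of "x \<otimes> c \<otimes> inv x" "x \<otimes> r \<otimes> inv x"] ij long by (simp add: short_elements_def)
qed

lemma short_elements_induct [consumes 1, case_names short mult]:
  assumes "a \<in> H"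
    and short: "\<And>c. c \<in> short_elements \<Longrightarrow> P c"
    and mult: "\<And>c r. c \<in> H \<Longrightarrow> r \<in> H \<Longrightarrow> P c \<Longrightarrow> P r \<Longrightarrow>
      conj_len c + conj_len r \<le> conj_len (c \<otimes> r) \<Longrightarrow> P (c \<otimes> r)"
  shows "P a"
  using assms(1)
proof (induction "conj_len a" arbitrary: a rule: less_induct)
  case less
  show ?case
  proof (cases "conj_len a \<le> card (rcosets H)")
    case True
    then show ?thesis using less short by (simp add: short_elements_def)
  next
    case False
    then obtain c r where cr: "c \<in> short_elements" "r \<in> H" "a = c \<otimes> r"
      "conj_len c + conj_len r \<le> conj_len a" "conj_len r < conj_len a"
      using split_off_short_loop[OF less.prems] by (metis not_le)
    then have "c \<in> H" by (simp add: short_elements_def)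
    then show ?thesis using cr less.hyps[of r] short[of c] mult[of c r] by simp
  qed
qed

abbreviation "GH \<equiv> G\<lparr>carrier := H\<rparr>"

interpretation GH: comm_group GH by (fact comm_group_H)

definition short_power_product :: "('a \<Rightarrow> nat) \<Rightarrow> 'a" where
  "short_power_product m = finprod GH (\<lambda>c. c [^] m c) short_elements"

lemma short_in_H: "c \<in> short_elements \<Longrightarrow> c \<in> H"
  by (simp add: short_elements_def)

lemma short_powers_Pi: "(\<lambda>c. c [^] (m c :: nat)) \<in> short_elements \<rightarrow> carrier GH"
  using pow_in_H short_in_H by auto

lemma short_power_product_closed: "short_power_product m \<in> H"
  using GH.finprod_closed[OF short_powers_Pi[of m]] by (simp add: short_power_product_def)

lemma short_power_product_add:
  "short_power_product (\<lambda>c. m c + k c) = short_power_product m \<otimes> short_power_product k"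
proof -
  have "short_power_product (\<lambda>c. m c + k c)
      = finprod GH (\<lambda>c. c [^] m c \<otimes>\<^bsub>GH\<^esub> c [^] k c) short_elements"
    unfolding short_power_product_def
    by (intro GH.finprod_cong') (auto simp: nat_pow_mult H_carrier short_in_H pow_in_H)
  also have "\<dots> = short_power_product m \<otimes> short_power_product k"
    using GH.finprod_multf[OF short_powers_Pi[of m] short_powers_Pi[of k]]
    by (simp add: short_power_product_def)
  finally show ?thesis .
qed

text \<open>
  All loops are collected by the element of \<open>short_elements\<close> that they represent, which is possible since \<open>H\<close> is
  abelian.
\<close>
lemma short_power_product_exists:
  assumes "a \<in> H"
  shows "\<exists>m. a = short_power_product m \<and> (\<Sum>c\<in>short_elements. m c * conj_len c) \<le> conj_len a"
  using assms
proof (induction rule: short_elements_induct)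
  case (short c)
  let ?m = "\<lambda>x. if c = x then 1 else 0 :: nat"
  have "short_power_product ?m = finprod GH (\<lambda>x. if c = x then x else \<one>\<^bsub>GH\<^esub>) short_elements"
    unfolding short_power_product_def
    by (intro GH.finprod_cong') (auto simp: H_carrier short_in_H)
  also have "\<dots> = c"
    using short finite_short_elements by (intro GH.finprod_singleton) (auto simp: short_in_H)
  finally have "c = short_power_product ?m" by simp
  moreover have "(\<Sum>x\<in>short_elements. ?m x * conj_len x) = conj_len c"
    using short finite_short_elements by (simp add: if_distrib[of "\<lambda>n. n * _"] cong: if_cong)
  ultimately show ?case by (intro exI[of _ ?m]) simp
next
  case (mult c r)
  then obtain m k where
    "c = short_power_product m" "(\<Sum>c\<in>short_elements. m c * conj_len c) \<le> conj_len c"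
    "r = short_power_product k" "(\<Sum>c\<in>short_elements. k c * conj_len c) \<le> conj_len r" by blast
  with mult show ?case
    by (intro exI[of _ "\<lambda>c. m c + k c"])
       (simp add: short_power_product_add distrib_right sum.distrib)
qed

lemma H_eq_generate: "H = generate GH short_elements"
proof
  show "generate GH short_elements \<subseteq> H"
    using GH.generate_incl[of short_elements] short_in_H by auto
  show "H \<subseteq> generate GH short_elements"
  proof
    fix a assume "a \<in> H"
    then show "a \<in> generate GH short_elements"
    proof (induction rule: short_elements_induct)
      case (mult c r)
      then show ?case using generate.eng[of c GH short_elements r] by simp
    qed (rule generate.incl)
  qed
qed

lemma finite_square_roots_H: "finite {x \<in> H. x \<otimes> x = y}"
proof -
  have "finite {x \<in> generate GH short_elements. x \<otimes>\<^bsub>GH\<^esub> x = \<one>\<^bsub>GH\<^esub>}"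
    using short_in_H by (intro GH.finite_two_torsion_generate finite_short_elements) auto
  then show ?thesis
    using GH.finite_square_roots[of y] by (simp flip: H_eq_generate)
qed

lemma len_finprod_le:
  assumes "finite A" "f \<in> A \<rightarrow> H"
  shows "len (finprod GH f A) \<le> (\<Sum>x\<in>A. len (f x))"
  using assms
proof (induction A)
  case (insert x A)
  have "finprod GH f A \<in> H" using insert GH.finprod_closed[of f A] by auto
  then have "len (f x \<otimes> finprod GH f A) \<le> len (f x) + len (finprod GH f A)"
    using insert by (intro len_mult) (auto simp: H_carrier)
  then show ?case using insert by (simp add: Pi_def)
qed simp

text \<open>
  Conjugating back costs \<open>2 * D\<close> for each power, not for each factor, so the error does not depend
  on the exponents.
\<close>
lemma len_short_power_product_le:
  "len (short_power_product m)
     \<le> (\<Sum>c\<in>short_elements. m c * conj_len c) + card short_elements * (2 * D)"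
proof -
  have "len (short_power_product m) \<le> (\<Sum>c\<in>short_elements. len (c [^] m c))"
    unfolding short_power_product_def
    using short_powers_Pi[of m] finite_short_elements by (intro len_finprod_le) auto
  also have "\<dots> \<le> (\<Sum>c\<in>short_elements. m c * conj_len c + 2 * D)"
    by (intro sum_mono len_pow_le short_in_H)
  finally show ?thesis by (simp add: sum.distrib)
qed

text \<open>
  Halving the exponents in a decomposition of \<open>a \<otimes> a\<close> gives an element \<open>b\<close> that is about half as long.
  The remainders are 0 or 1, so \<open>a \<otimes> inv b\<close> is a square root of one of finitely many elements.
\<close>
theorem len_square_ge: "\<exists>C. \<forall>a\<in>H. 2 * len a \<le> len (a \<otimes> a) + C"
proof -
  define Y where "Y = short_power_product ` (short_elements \<rightarrow>\<^sub>E {0, 1})"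
  define R where "R = {x \<in> H. x \<otimes> x \<in> Y}"
  have "finite Y" unfolding Y_def by (intro finite_imageI finite_PiE finite_short_elements) simp
  then have "finite (\<Union>y\<in>Y. {x \<in> H. x \<otimes> x = y})" using finite_square_roots_H by blast
  then have "finite R" unfolding R_def by (rule rev_finite_subset) auto
  define K where "K = Max (len ` R)"
  let ?C = "2 * K + 2 * (card short_elements * (2 * D))"
  have "2 * len a \<le> len (a \<otimes> a) + ?C" if a: "a \<in> H" for a
  proof -
    obtain m where m: "a \<otimes> a = short_power_product m"
      "(\<Sum>c\<in>short_elements. m c * conj_len c) \<le> conj_len (a \<otimes> a)"
      using short_power_product_exists[of "a \<otimes> a"] a by auto
    define b where "b = short_power_product (\<lambda>c. m c div 2)"
    define y where "y = short_power_product (\<lambda>c. m c mod 2)"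
    have bH: "b \<in> H" and yH: "y \<in> H" by (auto simp: b_def y_def short_power_product_closed)
    have "m = (\<lambda>c. (m c div 2 + m c div 2) + m c mod 2)" by (rule ext) presburger
    then have "short_power_product m = (b \<otimes> b) \<otimes> y"
      using short_power_product_add[of "\<lambda>c. m c div 2 + m c div 2" "\<lambda>c. m c mod 2"]
        short_power_product_add[of "\<lambda>c. m c div 2" "\<lambda>c. m c div 2"]
      by (simp add: b_def y_def)
    then have sq: "a \<otimes> a = (b \<otimes> b) \<otimes> y" using m by simp
    have "y = short_power_product (restrict (\<lambda>c. m c mod 2) short_elements)"
      unfolding y_def short_power_product_def
      by (intro GH.finprod_cong') (auto simp: pow_in_H short_in_H)
    moreover have "restrict (\<lambda>c. m c mod 2) short_elements \<in> short_elements \<rightarrow>\<^sub>E {0, 1}" by auto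
    ultimately have "y \<in> Y" unfolding Y_def by blast
    have "(a \<otimes> inv b) \<otimes> (a \<otimes> inv b) = (a \<otimes> a) \<otimes> inv (b \<otimes> b)"
    proof -
      have "inv b \<otimes> a = a \<otimes> inv b" using a bH by (intro H_comm) auto
      then have "(a \<otimes> inv b) \<otimes> (a \<otimes> inv b) = a \<otimes> (a \<otimes> inv b) \<otimes> inv b"
        using a bH by (simp add: H_carrier m_assoc flip: m_assoc[of "inv b" a])
      then show ?thesis using a bH by (simp add: H_carrier m_assoc inv_mult_group)
    qed
    also have "\<dots> = y"
    proof -
      have "(b \<otimes> b) \<otimes> y = y \<otimes> (b \<otimes> b)" using bH yH by (intro H_comm) auto
      then show ?thesis using sq bH yH by (simp add: m_assoc H_carrier)
    qed
    finally have "a \<otimes> inv b \<in> R" using \<open>y \<in> Y\<close> a bH by (simp add: R_def)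
    then have "len (a \<otimes> inv b) \<le> K" using \<open>finite R\<close> by (simp add: K_def)
    moreover have "a = (a \<otimes> inv b) \<otimes> b" using a bH by (simp add: m_assoc H_carrier)
    then have "len a \<le> len (a \<otimes> inv b) + len b"
      using len_mult[of "a \<otimes> inv b" b] a bH by (simp add: H_carrier)
    moreover have "2 * len b \<le> conj_len (a \<otimes> a) + 2 * (card short_elements * (2 * D))"
    proof -
      have "2 * (\<Sum>c\<in>short_elements. m c div 2 * conj_len c) \<le> (\<Sum>c\<in>short_elements. m c * conj_len c)"
        unfolding sum_distrib_left
        by (intro sum_mono) (simp flip: mult.assoc)
      then show ?thesis using len_short_power_product_le[of "\<lambda>c. m c div 2"] m by (simp add: b_def)
    qed
    moreover have "conj_len (a \<otimes> a) \<le> len (a \<otimes> a)" using a by (intro conj_len_le_len) (auto simp: H_carrier)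
    ultimately show ?thesis by linarith
  qed
  then show ?thesis by blast
qed

theorem len_pow_two_ge:
  "\<exists>C::real. \<forall>a\<in>H. \<forall>k. 2 ^ k * (len a - C) \<le> len (a [^] (2 ^ k :: nat))"
proof -
  obtain C where C: "\<And>a. a \<in> H \<Longrightarrow> 2 * len a \<le> len (a \<otimes> a) + C" using len_square_ge by blast
  \<comment> \<open>the additional summand \<open>C\<close> makes the induction go through\<close>
  have "2 ^ k * (len a - real C) + C \<le> len (a [^] (2 ^ k :: nat))" if a: "a \<in> H" for a k
  proof (induction k)
    case (Suc k)
    let ?b = "a [^] (2 ^ k :: nat)"
    have "a [^] (2 ^ Suc k :: nat) = ?b \<otimes> ?b"
      using a by (simp add: nat_pow_mult H_carrier mult_2)
    then have "2 * real (len ?b) \<le> len (a [^] (2 ^ Suc k :: nat)) + real C"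
      using C[OF pow_in_H[OF a, of "2 ^ k"]] by (metis of_nat_add of_nat_le_iff of_nat_mult of_nat_numeral)
    with Suc show ?case by (simp add: algebra_simps)
  qed (use a in \<open>simp add: H_carrier\<close>)
  then show ?thesis by (intro exI[of _ "real C"]) (smt (verit) of_nat_0_le_iff)
qed

section \<open>A test function for the lower bound\<close>

text \<open>
  An average of 1-Lipschitz functions of \<open>x\<close>. It is a finite substitute for a linear functional that norms
  \<open>a\<close> on \<open>H\<close>: a translation by \<open>a\<close> shifts the summands, so the difference telescopes.
\<close>
definition orbit_height :: "'a \<Rightarrow> nat \<Rightarrow> 'a \<Rightarrow> real" where
  "orbit_height a K x = - (\<Sum>i<K. real (d (a [^] i \<otimes> x) (a [^] K))) / K"

lemma orbit_height_lipschitz: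
  assumes "a \<in> carrier G" "x \<in> carrier G" "y \<in> carrier G" "0 < K"
  shows "orbit_height a K y - orbit_height a K x \<le> d x y"
proof -
  have "real (d (a [^] i \<otimes> x) (a [^] K)) \<le> d (a [^] i \<otimes> y) (a [^] K) + d x y" for i :: nat
    using dist_triangle[of "a [^] i \<otimes> x" "a [^] i \<otimes> y" "a [^] K"] dist_translate[of "a [^] i" x y]
      assms by simp
  then have "(\<Sum>i<K. real (d (a [^] i \<otimes> x) (a [^] K))) \<le> (\<Sum>i<K. d (a [^] i \<otimes> y) (a [^] K) + real (d x y))"
    by (intro sum_mono) auto
  also have "\<dots> = (\<Sum>i<K. real (d (a [^] i \<otimes> y) (a [^] K))) + K * d x y"
    by (simp add: sum.distrib)
  finally show ?thesis using assms(4) by (simp add: orbit_height_def field_simps)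
qed

lemma orbit_height_translate:
  assumes a: "a \<in> carrier G" and x: "x \<in> carrier G" and K: "0 < K"
  shows "orbit_height a K (a \<otimes> x) - orbit_height a K x \<ge> (len (a [^] K) - 2 * real (len x)) / K"
proof -
  let ?f = "\<lambda>i::nat. real (d (a [^] i \<otimes> x) (a [^] K))"
  have "a [^] i \<otimes> (a \<otimes> x) = a [^] Suc i \<otimes> x" for i :: nat
    using a x by (simp add: m_assoc)
  then have "orbit_height a K (a \<otimes> x) - orbit_height a K x = ((\<Sum>i<K. ?f i) - (\<Sum>i<K. ?f (Suc i))) / K"
    by (simp add: orbit_height_def diff_divide_distrib)
  also have "(\<Sum>i<K. ?f i) - (\<Sum>i<K. ?f (Suc i)) = ?f 0 - ?f K"
    unfolding sum_subtractf[symmetric] by (rule sum_lessThan_telescope')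
  finally have eq: "orbit_height a K (a \<otimes> x) - orbit_height a K x = (?f 0 - ?f K) / K" .
  have "len (a [^] K) \<le> d \<one> x + d x (a [^] K)"
    using dist_triangle[of \<one> x "a [^] K"] a x by (simp add: len_def)
  moreover have "d (a [^] K \<otimes> x) (a [^] K) = len x"
    using a x len_inv by (simp add: dist_eq_len inv_mult_group m_assoc)
  ultimately have "real (len (a [^] K)) - 2 * len x \<le> ?f 0 - ?f K"
    using a x by (simp add: len_def)
  then show ?thesis unfolding eq by (intro divide_right_mono) simp_all
qed

text \<open>
  The Lipschitz function for \<open>g = a \<otimes> t\<close> is the one of \<open>a\<close>. The walks from \<open>g\<close> and \<open>a\<close>, which are at
  bounded distance, give it nearly the same expectation by \<open>walk_coupling_exists\<close>.
\<close>
lemma walk_expectation_ge: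
  "\<exists>C::real. \<forall>n. \<forall>g\<in>carrier G. \<exists>f.
    (\<forall>x\<in>carrier G. \<forall>y\<in>carrier G. f y - f x \<le> real (d x y)) \<and>
    len g - C \<le> measure_pmf.expectation (walk_from n g) f - measure_pmf.expectation (walk_from n \<one>) f"
proof -
  obtain C :: real where C: "\<And>a k. a \<in> H \<Longrightarrow> 2 ^ k * (len a - C) \<le> len (a [^] (2 ^ k :: nat))"
    using len_pow_two_ge by blast
  have "\<exists>f. (\<forall>x\<in>carrier G. \<forall>y\<in>carrier G. f y - f x \<le> real (d x y)) \<and>
    len g - (C + 1 + 2 * D + coupling_cost)
      \<le> measure_pmf.expectation (walk_from n g) f - measure_pmf.expectation (walk_from n \<one>) f"
    if g: "g \<in> carrier G" for n g
  proof -
    obtain a t where at: "a \<in> H" "t \<in> carrier G" "len t \<le> D" "g = a \<otimes> t"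
      using transversal[OF g] by blast
    have a: "a \<in> carrier G" using at H_carrier by blast
    \<comment> \<open>a power of two, so large that displacements of up to \<open>2 * n\<close> change the average by at most 1\<close>
    define K :: nat where "K = 2 ^ Suc n"
    have K: "0 < K" by (simp add: K_def)
    define f where "f = orbit_height a K"
    have lip: "f y - f x \<le> real (d x y)" if "x \<in> carrier G" "y \<in> carrier G" for x y
      using orbit_height_lipschitz[OF a that K] by (simp add: f_def)
    have int: "integrable (measure_pmf (walk_pmf n)) h" for h :: "'a \<Rightarrow> real"
      by (intro integrable_measure_pmf_finite) simp
    have "2 * n \<le> K" using less_exp[of n] by (simp add: K_def)
    then have "real (2 * n) \<le> real K" by (simp only: of_nat_le_iff)
    then have nK: "2 * real n / K \<le> 1" using K by (simp add: divide_le_eq)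
    have "len a - C - 1 \<le> f (a \<otimes> x) - f (\<one> \<otimes> x)" if x: "x \<in> set_pmf (walk_pmf n)" for x
    proof -
      have xc: "x \<in> carrier G" "len x \<le> n" using walk_len[OF x] by auto
      have "K * (len a - C) \<le> len (a [^] K)" using C[OF at(1), of "Suc n"] by (simp add: K_def)
      then have "len a - C \<le> len (a [^] K) / K" using K by (simp add: field_simps)
      moreover have "2 * real (len x) / K \<le> 2 * real n / K" using xc by (intro divide_right_mono) auto
      ultimately show ?thesis
        using orbit_height_translate[OF a xc(1) K] nK xc by (simp add: f_def diff_divide_distrib)
    qed
    then have "measure_pmf.expectation (walk_pmf n) (\<lambda>_. len a - C - 1)
        \<le> measure_pmf.expectation (walk_pmf n) (\<lambda>x. f (a \<otimes> x) - f (\<one> \<otimes> x))"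
      by (intro expectation_mono_finite) auto
    then have A: "len a - C - 1
        \<le> measure_pmf.expectation (walk_from n a) f - measure_pmf.expectation (walk_from n \<one>) f"
      unfolding walk_from_def integral_map_pmf by (simp add: Bochner_Integration.integral_diff[OF int int])
    have dat: "d g a \<le> D" using at a len_inv[of t] by (simp add: dist_eq_len inv_mult_group m_assoc)
    obtain \<pi> where \<pi>: "map_pmf fst \<pi> = walk_from n g" "map_pmf snd \<pi> = walk_from n a"
      "measure_pmf.expectation \<pi> (\<lambda>(x, y). real (d x y)) \<le> d g a + coupling_cost"
      using walk_coupling_exists[OF g a] by (auto simp: walk_coupling_def)
    have fin: "finite (set_pmf \<pi>)" using finite_set_coupling \<pi> by blast
    have int\<pi>: "integrable (measure_pmf \<pi>) h" for h :: "'a \<times> 'a \<Rightarrow> real"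
      by (intro integrable_measure_pmf_finite fin)
    have "z \<in> carrier G \<times> carrier G" if "z \<in> set_pmf \<pi>" for z
      using that set_coupling_subset[OF \<pi>(1,2)] g a by (auto simp: walk_from_def walk_carrier)
    then have "measure_pmf.expectation \<pi> (\<lambda>z. f (snd z) - f (fst z))
        \<le> measure_pmf.expectation \<pi> (\<lambda>(x, y). real (d x y))"
      by (intro expectation_mono_finite fin) (use lip in auto)
    moreover have "measure_pmf.expectation \<pi> (\<lambda>z. f (snd z) - f (fst z))
        = measure_pmf.expectation (walk_from n a) f - measure_pmf.expectation (walk_from n g) f"
      unfolding \<pi>(1,2)[symmetric] integral_map_pmf by (rule Bochner_Integration.integral_diff[OF int\<pi> int\<pi>])
    ultimately have B: "measure_pmf.expectation (walk_from n a) f - measure_pmf.expectation (walk_from n g) f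
        \<le> D + coupling_cost" using \<pi>(3) dat by linarith
    have "len g \<le> len a + D" using len_mult[OF a at(2)] at by simp
    then have "len g - (C + 1 + 2 * D + coupling_cost)
      \<le> measure_pmf.expectation (walk_from n g) f - measure_pmf.expectation (walk_from n \<one>) f"
      using A B by linarith
    then show ?thesis using lip by blast
  qed
  then show ?thesis by blast
qed

section \<open>The Wasserstein distance of two walks\<close>

lemma convolution_power_eq_pmf:
  "x \<in> carrier G \<Longrightarrow> convolution_power G (lazy_step G S) n x = pmf (walk_pmf n) x"
proof (induction n arbitrary: x)
  case 0
  then show ?case by (simp add: pmf_return indicator_def)
next
  case (Suc n)
  let ?A = "set_pmf (walk_pmf n)"
  have "convolution_power G (lazy_step G S) (Suc n) x
      = (\<Sum>\<^sub>\<infinity>h\<in>carrier G. pmf (walk_pmf n) h * lazy_step G S (inv h \<otimes> x))"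
    using Suc.IH by (simp add: convolution_def cong: infsum_cong)
  also have "\<dots> = (\<Sum>\<^sub>\<infinity>h\<in>?A. pmf (walk_pmf n) h * lazy_step G S (inv h \<otimes> x))"
    by (intro infsum_cong_neutral) (auto simp: walk_carrier set_pmf_iff)
  also have "\<dots> = (\<Sum>h\<in>?A. pmf (walk_pmf n) h * lazy_step G S (inv h \<otimes> x))" by simp
  also have "\<dots> = (\<Sum>h\<in>?A. pmf (map_pmf ((\<otimes>) h) step_pmf) x * pmf (walk_pmf n) h)"
  proof (intro sum.cong refl)
    fix h assume "h \<in> ?A"
    then have h: "h \<in> carrier G" by (rule walk_carrier)
    have "pmf (map_pmf ((\<otimes>) h) step_pmf) x = pmf step_pmf (inv h \<otimes> x)"
    proof (cases "inv h \<otimes> x \<in> set_pmf step_pmf")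
      case True
      have "inj_on ((\<otimes>) h) (set_pmf step_pmf)"
        using h by (intro inj_onI) (simp add: step_carrier)
      from pmf_map_inj[OF this True] show ?thesis using h Suc.prems by (simp add: inv_cancel_left')
    next
      case False
      then have "x \<notin> (\<otimes>) h ` set_pmf step_pmf"
        using h by (auto simp: inv_cancel_left step_carrier)
      with False show ?thesis by (simp add: pmf_map_outside set_pmf_iff)
    qed
    then show "pmf (walk_pmf n) h * lazy_step G S (inv h \<otimes> x)
      = pmf (map_pmf ((\<otimes>) h) step_pmf) x * pmf (walk_pmf n) h" by (simp add: pmf_step_pmf)
  qed
  also have "\<dots> = pmf (walk_pmf (Suc n)) x"
    unfolding walk_pmf_Suc_right pmf_bind
    by (rule integral_measure_pmf_real[symmetric]) auto
  finally show ?case .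
qed

lemma lazy_walk_eq_pmf:
  assumes g: "g \<in> carrier G" and x: "x \<in> carrier G"
  shows "lazy_walk G S n g x = pmf (walk_from n g) x"
proof -
  have "pmf (map_pmf ((\<otimes>) g) (walk_pmf n)) x = pmf (walk_pmf n) (inv g \<otimes> x)"
  proof (cases "inv g \<otimes> x \<in> set_pmf (walk_pmf n)")
    case True
    have "inj_on ((\<otimes>) g) (set_pmf (walk_pmf n))"
      using g by (intro inj_onI) (simp add: walk_carrier)
    from pmf_map_inj[OF this True] show ?thesis using g x by (simp add: inv_cancel_left')
  next
    case False
    then have "x \<notin> (\<otimes>) g ` set_pmf (walk_pmf n)"
      using g by (auto simp: inv_cancel_left walk_carrier)
    with False show ?thesis by (simp add: pmf_map_outside set_pmf_iff)
  qed
  then show ?thesis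
    using g x convolution_power_eq_pmf[of "inv g \<otimes> x" n] by (simp add: lazy_walk_def walk_from_def)
qed

text \<open>
  The easy half of Kantorovich duality. Since the marginals have finite support, so does the coupling, and
  all infinite sums are finite.
\<close>
lemma coupling_cost_ge:
  fixes f :: "'a \<Rightarrow> real" and g h :: 'a
  assumes g: "g \<in> carrier G" and h: "h \<in> carrier G"
    and \<pi>: "\<pi> \<in> couplings (carrier G) (lazy_walk G S n g) (lazy_walk G S n h)"
    and cost: "((\<lambda>(x, y). real (d x y) * \<pi> (x, y)) has_sum c) (carrier G \<times> carrier G)"
    and lip: "\<And>x y. x \<in> carrier G \<Longrightarrow> y \<in> carrier G \<Longrightarrow> f y - f x \<le> real (d x y)"
  shows "measure_pmf.expectation (walk_from n h) f - measure_pmf.expectation (walk_from n g) f \<le> c"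
proof -
  let ?A = "set_pmf (walk_from n g)" and ?B = "set_pmf (walk_from n h)"
  have AB: "?A \<subseteq> carrier G" "?B \<subseteq> carrier G" using g h by (auto simp: walk_from_def walk_carrier)
  have nonneg: "0 \<le> \<pi> (x, y)" if "x \<in> carrier G" "y \<in> carrier G" for x y
    using \<pi> that by (auto simp: couplings_def)
  have row: "((\<lambda>y. \<pi> (x, y)) has_sum pmf (walk_from n g) x) (carrier G)" if "x \<in> carrier G" for x
    using \<pi> that lazy_walk_eq_pmf[OF g that, of n] by (auto simp: couplings_def)
  have col: "((\<lambda>x. \<pi> (x, y)) has_sum pmf (walk_from n h) y) (carrier G)" if "y \<in> carrier G" for y
    using \<pi> that lazy_walk_eq_pmf[OF h that, of n] by (auto simp: couplings_def)
  have le: "\<pi> (x, y) \<le> pmf (walk_from n g) x" "\<pi> (x, y) \<le> pmf (walk_from n h) y"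
    if xy: "x \<in> carrier G" "y \<in> carrier G" for x y
    using has_sum_mono_neutral[OF has_sum_finite[of "{y}" "\<lambda>y. \<pi> (x, y)"] row[OF xy(1)]]
      has_sum_mono_neutral[OF has_sum_finite[of "{x}" "\<lambda>x. \<pi> (x, y)"] col[OF xy(2)]] xy nonneg
    by auto
  have zero: "\<pi> (x, y) = 0" if "x \<in> carrier G" "y \<in> carrier G" "x \<notin> ?A \<or> y \<notin> ?B" for x y
    using that le[of x y] nonneg[of x y] by (auto simp: set_pmf_iff)
  have row_sum: "(\<Sum>y\<in>?B. \<pi> (x, y)) = pmf (walk_from n g) x" if "x \<in> ?A" for x
  proof (rule has_sum_unique)
    show "((\<lambda>y. \<pi> (x, y)) has_sum (\<Sum>y\<in>?B. \<pi> (x, y))) ?B" by (rule has_sum_finite) simp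
    show "((\<lambda>y. \<pi> (x, y)) has_sum pmf (walk_from n g) x) ?B"
      by (rule has_sum_cong_neutral[THEN iffD1, OF _ _ _ row]) (use that AB zero in auto)
  qed
  have col_sum: "(\<Sum>x\<in>?A. \<pi> (x, y)) = pmf (walk_from n h) y" if "y \<in> ?B" for y
  proof (rule has_sum_unique)
    show "((\<lambda>x. \<pi> (x, y)) has_sum (\<Sum>x\<in>?A. \<pi> (x, y))) ?A" by (rule has_sum_finite) simp
    show "((\<lambda>x. \<pi> (x, y)) has_sum pmf (walk_from n h) y) ?A"
      by (rule has_sum_cong_neutral[THEN iffD1, OF _ _ _ col]) (use that AB zero in auto)
  qed
  have "c = (\<Sum>(x, y)\<in>?A \<times> ?B. real (d x y) * \<pi> (x, y))"
  proof (rule has_sum_unique)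
    show "((\<lambda>(x, y). real (d x y) * \<pi> (x, y)) has_sum c) (?A \<times> ?B)"
      by (rule has_sum_cong_neutral[THEN iffD1, OF _ _ _ cost]) (use AB zero in \<open>auto, blast+\<close>)
  qed (rule has_sum_finite, simp)
  also have "\<dots> \<ge> (\<Sum>(x, y)\<in>?A \<times> ?B. (f y - f x) * \<pi> (x, y))"
    by (intro sum_mono) (use AB in \<open>auto intro!: mult_right_mono lip nonneg\<close>)
  also have "(\<Sum>(x, y)\<in>?A \<times> ?B. (f y - f x) * \<pi> (x, y))
      = (\<Sum>x\<in>?A. \<Sum>y\<in>?B. f y * \<pi> (x, y)) - (\<Sum>x\<in>?A. \<Sum>y\<in>?B. f x * \<pi> (x, y))"
    by (simp add: sum.cartesian_product[symmetric] sum_subtractf left_diff_distrib)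
  also have "(\<Sum>x\<in>?A. \<Sum>y\<in>?B. f y * \<pi> (x, y)) = (\<Sum>y\<in>?B. f y * (\<Sum>x\<in>?A. \<pi> (x, y)))"
    by (subst sum.swap) (simp add: sum_distrib_left)
  also have "\<dots> = (\<Sum>y\<in>?B. f y * pmf (walk_from n h) y)" by (simp add: col_sum)
  also have "\<dots> = measure_pmf.expectation (walk_from n h) f"
    by (rule integral_measure_pmf_real[symmetric]) auto
  also have "(\<Sum>x\<in>?A. \<Sum>y\<in>?B. f x * \<pi> (x, y)) = (\<Sum>x\<in>?A. f x * (\<Sum>y\<in>?B. \<pi> (x, y)))"
    by (simp add: sum_distrib_left)
  also have "\<dots> = (\<Sum>x\<in>?A. f x * pmf (walk_from n g) x)" by (simp add: row_sum)
  also have "\<dots> = measure_pmf.expectation (walk_from n g) f"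
    by (rule integral_measure_pmf_real[symmetric]) auto
  finally show ?thesis .
qed

text \<open>
  A mass of a push-forward is a sum over a fibre. The map \<open>j\<close> parametrises the fibre, as \<open>Pair x\<close> does for
  the marginals of a coupling.
\<close>
lemma has_sum_pmf_fibre:
  assumes "finite (set_pmf \<pi>)" "inj j" "j ` A \<supseteq> {z \<in> set_pmf \<pi>. k z = x}" "\<And>y. k (j y) = x"
  shows "((\<lambda>y. pmf \<pi> (j y)) has_sum pmf (map_pmf k \<pi>) x) A"
proof -
  let ?F = "{z \<in> set_pmf \<pi>. k z = x}"
  have "pmf (map_pmf k \<pi>) x = (\<Sum>z\<in>?F. pmf \<pi> z)"
    using assms(1) by (simp add: pmf_map vimage_def measure_measure_pmf_finite[symmetric]
      measure_Int_set_pmf[symmetric, of _ "{z. k z = x}"] Int_def conj_commute)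
  then have "(pmf \<pi> has_sum pmf (map_pmf k \<pi>) x) ?F"
    using assms(1) by (simp add: has_sum_finiteI)
  then have "(pmf \<pi> has_sum pmf (map_pmf k \<pi>) x) (j ` A)"
    by (rule has_sum_cong_neutral[THEN iffD1, rotated -1])
       (use assms in \<open>auto simp: set_pmf_iff\<close>)
  then show ?thesis
    using has_sum_reindex[of j A "pmf \<pi>"] assms(2) by (simp add: o_def inj_on_subset[OF assms(2)])
qed

lemma coupling_of_pmf:
  assumes g: "g \<in> carrier G" and h: "h \<in> carrier G"
    and \<pi>: "map_pmf fst \<pi> = walk_from n g" "map_pmf snd \<pi> = walk_from n h"
  shows "pmf \<pi> \<in> couplings (carrier G) (lazy_walk G S n g) (lazy_walk G S n h)"
    and "((\<lambda>(x, y). real (d x y) * pmf \<pi> (x, y)) has_sum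
           measure_pmf.expectation \<pi> (\<lambda>(x, y). real (d x y))) (carrier G \<times> carrier G)"
proof -
  have fin: "finite (set_pmf \<pi>)" using finite_set_coupling \<pi> by blast
  have sub: "set_pmf \<pi> \<subseteq> carrier G \<times> carrier G"
    using set_coupling_subset[OF \<pi>] g h by (auto simp: walk_from_def walk_carrier)
  have "((\<lambda>y. pmf \<pi> (x, y)) has_sum lazy_walk G S n g x) (carrier G)" if x: "x \<in> carrier G" for x
    unfolding lazy_walk_eq_pmf[OF g x] \<pi>(1)[symmetric]
    by (rule has_sum_pmf_fibre[OF fin]) (use sub in \<open>auto intro: injI\<close>)
  moreover have "((\<lambda>x. pmf \<pi> (x, y)) has_sum lazy_walk G S n h y) (carrier G)" if y: "y \<in> carrier G" for y
    unfolding lazy_walk_eq_pmf[OF h y] \<pi>(2)[symmetric]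
    by (rule has_sum_pmf_fibre[OF fin]) (use sub in \<open>auto intro: injI\<close>)
  ultimately show "pmf \<pi> \<in> couplings (carrier G) (lazy_walk G S n g) (lazy_walk G S n h)"
    by (simp add: couplings_def)
  have "measure_pmf.expectation \<pi> (\<lambda>(x, y). real (d x y))
      = (\<Sum>z\<in>set_pmf \<pi>. (case z of (x, y) \<Rightarrow> real (d x y)) * pmf \<pi> z)"
    by (rule integral_measure_pmf_real[OF fin]) auto
  also have "\<dots> = (\<Sum>(x, y)\<in>set_pmf \<pi>. real (d x y) * pmf \<pi> (x, y))"
    by (simp add: case_prod_unfold)
  finally have "((\<lambda>(x, y). real (d x y) * pmf \<pi> (x, y)) has_sum
           measure_pmf.expectation \<pi> (\<lambda>(x, y). real (d x y))) (set_pmf \<pi>)"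
    using fin by (simp add: has_sum_finiteI)
  then show "((\<lambda>(x, y). real (d x y) * pmf \<pi> (x, y)) has_sum
           measure_pmf.expectation \<pi> (\<lambda>(x, y). real (d x y))) (carrier G \<times> carrier G)"
    by (rule has_sum_cong_neutral[THEN iffD1, rotated -1]) (use sub in \<open>auto simp: set_pmf_iff\<close>)
qed

theorem wasserstein_bound:
  "\<exists>C::real. \<forall>n. \<forall>g\<in>carrier G.
    \<bar>wasserstein1 (carrier G) (\<lambda>x y. real (d x y)) (lazy_walk G S n \<one>) (lazy_walk G S n g) - d \<one> g\<bar> \<le> C"
proof -
  obtain C :: real where C: "\<forall>n. \<forall>g\<in>carrier G. \<exists>f.
    (\<forall>x\<in>carrier G. \<forall>y\<in>carrier G. f y - f x \<le> real (d x y)) \<and>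
    len g - C \<le> measure_pmf.expectation (walk_from n g) f - measure_pmf.expectation (walk_from n \<one>) f"
    using walk_expectation_ge ..
  have "\<bar>wasserstein1 (carrier G) (\<lambda>x y. real (d x y)) (lazy_walk G S n \<one>) (lazy_walk G S n g) - d \<one> g\<bar>
      \<le> max C coupling_cost" if g: "g \<in> carrier G" for n g
  proof -
    have one: "\<one> \<in> carrier G" by simp
    define costs where "costs = {c. \<exists>\<pi>\<in>couplings (carrier G) (lazy_walk G S n \<one>) (lazy_walk G S n g).
      ((\<lambda>(x, y). real (d x y) * \<pi> (x, y)) has_sum c) (carrier G \<times> carrier G)}"
    obtain f where f: "\<And>x y. x \<in> carrier G \<Longrightarrow> y \<in> carrier G \<Longrightarrow> f y - f x \<le> real (d x y)"
      "len g - C \<le> measure_pmf.expectation (walk_from n g) f - measure_pmf.expectation (walk_from n \<one>) f"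
      using bspec[OF spec[OF C, of n] g] by auto
    have lower: "d \<one> g - C \<le> c" if c: "c \<in> costs" for c
    proof -
      obtain \<pi> where "\<pi> \<in> couplings (carrier G) (lazy_walk G S n \<one>) (lazy_walk G S n g)"
        "((\<lambda>(x, y). real (d x y) * \<pi> (x, y)) has_sum c) (carrier G \<times> carrier G)"
        using c unfolding costs_def by blast
      from coupling_cost_ge[OF one g this f(1)] show ?thesis
        using f(2) by (simp add: len_def)
    qed
    obtain \<pi> where \<pi>: "map_pmf fst \<pi> = walk_from n \<one>" "map_pmf snd \<pi> = walk_from n g"
      "measure_pmf.expectation \<pi> (\<lambda>(x, y). real (d x y)) \<le> d \<one> g + coupling_cost"
      using walk_coupling_exists[OF one g] by (auto simp: walk_coupling_def)
    have mem: "measure_pmf.expectation \<pi> (\<lambda>(x, y). real (d x y)) \<in> costs"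
      unfolding costs_def using coupling_of_pmf[OF one g \<pi>(1,2)] by blast
    have "Inf costs \<le> d \<one> g + coupling_cost"
      using cInf_lower[OF mem bdd_belowI[OF lower]] \<pi>(3) by linarith
    moreover have "d \<one> g - C \<le> Inf costs"
      using mem lower by (intro cInf_greatest) auto
    moreover have "wasserstein1 (carrier G) (\<lambda>x y. real (d x y)) (lazy_walk G S n \<one>) (lazy_walk G S n g) = Inf costs"
      by (simp only: wasserstein1_def costs_def)
    ultimately show ?thesis by linarith
  qed
  then show ?thesis by blast
qed

end

section \<open>The curvature bound\<close>

theorem theorem1p13:
  fixes G :: "('a, 'b) monoid_scheme" and S :: "'a set"
  assumes "group G"
    and "virtually_abelian G"
    and "finite S"
    and "S \<subseteq> carrier G"
    and "generate G S = carrier G"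
    and "set_inv\<^bsub>G\<^esub> S = S"
    and "\<one>\<^bsub>G\<^esub> \<notin> S"
  shows "\<exists>C::real. \<forall>g\<in>carrier G - {\<one>\<^bsub>G\<^esub>}. \<forall>n::nat.
           \<bar>ollivier_ricci G S n \<one>\<^bsub>G\<^esub> g\<bar> \<le> C / real (cayley_dist G S \<one>\<^bsub>G\<^esub> g)"
proof (cases "S = {}")
  case True
  interpret group G by (fact assms(1))
  have "carrier G = {\<one>\<^bsub>G\<^esub>}" using assms(5) True generate_empty by simp
  then show ?thesis by simp
next
  case False
  obtain H where H: "H \<lhd> G" "comm_group (G\<lparr>carrier := H\<rparr>)" "finite (rcosets\<^bsub>G\<^esub> H)"
    using assms(2) by (auto simp: virtually_abelian_def)
  interpret group G by (fact assms(1))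
  interpret virtually_abelian_cayley_graph G S H
    using assms H False
    by (intro virtually_abelian_cayley_graph.intro cayley_graph.intro cayley_graph_axioms.intro
        virtually_abelian_cayley_graph_axioms.intro) auto
  obtain C :: real where C: "\<forall>n. \<forall>g\<in>carrier G. \<bar>wasserstein1 (carrier G) (\<lambda>x y. real (d x y))
      (lazy_walk G S n \<one>\<^bsub>G\<^esub>) (lazy_walk G S n g) - d \<one>\<^bsub>G\<^esub> g\<bar> \<le> C"
    using wasserstein_bound ..
  have "\<bar>ollivier_ricci G S n \<one>\<^bsub>G\<^esub> g\<bar> \<le> C / d \<one>\<^bsub>G\<^esub> g"
    if g: "g \<in> carrier G - {\<one>\<^bsub>G\<^esub>}" for n g
  proof -
    let ?W = "wasserstein1 (carrier G) (\<lambda>x y. real (d x y)) (lazy_walk G S n \<one>\<^bsub>G\<^esub>) (lazy_walk G S n g)"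
    have pos: "0 < real (d \<one>\<^bsub>G\<^esub> g)" using len_pos[of g] g by (simp add: len_def)
    then have "ollivier_ricci G S n \<one>\<^bsub>G\<^esub> g = - (?W - d \<one>\<^bsub>G\<^esub> g) / d \<one>\<^bsub>G\<^esub> g"
      by (simp add: ollivier_ricci_def field_simps)
    then have "\<bar>ollivier_ricci G S n \<one>\<^bsub>G\<^esub> g\<bar> = \<bar>?W - d \<one>\<^bsub>G\<^esub> g\<bar> / d \<one>\<^bsub>G\<^esub> g"
      using pos by (simp add: abs_minus_commute)
    also have "\<dots> \<le> C / d \<one>\<^bsub>G\<^esub> g"
      using C g pos by (intro divide_right_mono) auto
    finally show ?thesis .
  qed
  then show ?thesis by blast
qed

end
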